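(* Let $n_1,n_2,p$ be positive integers, $A_i\in\mathbb{R}^{p\times n_i}$ ($i=1,2$), $b\in\mathbb{R}^p$, let $\mathcal{X}_i\subseteq\mathbb{R}^{n_i}$ ($i=1,2$) be closed convex sets, let $f_i:\mathbb{R}^{n_i}\to\mathbb{R}$ ($i=1,2$) be lower semicontinuous, proper closed convex functions, and let $f_3:\mathbb{R}^p\to\mathbb{R}$ be differentiable, bounded below, strongly convex with modulus $\sigma>0$, with $\nabla f_3$ Lipschitz continuous with constant $L>0$. Consider the problem $$\min\ f_1(x_1)+f_2(x_2)+f_3(x_3)\quad\text{s.t.}\quad A_1x_1+A_2x_2+x_3=b,\ x_1\in\mathcal{X}_1,\ x_2\in\mathcal{X}_2,\qquad (P)$$ and let $f^*$ denote its optimal value. Assume that the set $\Omega^*$ of optimal primal and dual pairs of $(P)$ is nonempty, that $A_1$ and $A_2$ have full column rank, and that $f_i+\mathbf{1}_{\mathcal{X}_i}$ is coercive for $i=1,2$. Let $\gamma>0$ and let $\{(x_1^k,x_2^k,x_3^k,\lambda^k)\}_{k\ge 0}$ be generated by the 3-block ADMM (defined in the context) with penalty parameter $\gamma$ from an arbitrary starting point. Then: 1. If $\gamma\in(L^2/\sigma,+\infty)$, then $\{(x_1^k,x_2^k,x_3^k,\lambda^k):k=0,1,2,\dots\}$ is a bounded sequence and each of its cluster points is an optimal primal and dual pair of $(P)$. Moreover, $$\lim_{k\to\infty}\left|f_1(x_1^k)+f_2(x_2^k)+f_3(x_3^k)-f^*\right|=0,\qquad \lim_{k\to\infty}\left\|A_1x_1^k+A_2x_2^k+x_3^k-b\right\|=0.$$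 Additionally, if one of the following two conditions holds: (i) the matrix $[A_1\ A_2]$ has full column rank; or (ii) for $i=1,2$, $f_i$ is locally strongly convex in the sense defined in the context; then the whole sequence $\{(x_1^k,x_2^k,x_3^k,\lambda^k)\}$ converges to an optimal primal and dual pair of $(P)$. 2. If $$\gamma\in\left(\sqrt{\sigma^2+\frac{2L^2}{\eta_1-2}}-\sigma,\ \frac{4\sigma}{\eta_1}\right]\ \bigcup\ \left(0,\ \min\left\{\frac{4\sigma}{\eta_2},\ \frac{\sigma(\eta_2-2)}{4\eta_2}+\sqrt{\frac{\sigma^2(\eta_2-2)^2}{16\eta_2^2}+\frac{\sigma^2(\eta_2-2)}{4\eta_2}}\right\}\right)$$ with $\eta_1,\eta_2$ arbitrarily chosen in $(2,+\infty)$ (the first interval being empty if its left endpoint is not smaller than its right endpoint), then $\{(x_1^k,x_2^k,x_3^k,\lambda^k):k=0,1,2,\dots\}$ is a bounded sequence and the whole sequence converges to an optimal primal and dual pair of $(P)$.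
   Context: All norms are Euclidean. Strong convexity of $f_3$ with modulus $\sigma$ means $f_3(y)\ge f_3(x)+(y-x)^\top\nabla f_3(x)+\frac{\sigma}{2}\|y-x\|^2$ for all $x,y\in\mathbb{R}^p$; Lipschitz continuity of the gradient means $\|\nabla f_3(y)-\nabla f_3(x)\|\le L\|y-x\|$ for all $x,y\in\mathbb{R}^p$. $\mathbf{1}_{\mathcal{X}_i}$ is the indicator function of $\mathcal{X}_i$ (equal to $0$ on $\mathcal{X}_i$ and $+\infty$ elsewhere). A function $h$ is coercive if $h(x)\to+\infty$ as $\|x\|\to\infty$. Optimal primal and dual pair: $(x_1^*,x_2^*,x_3^*,\lambda^* )$ with $x_1^*\in\mathcal{X}_1$, $x_2^*\in\mathcal{X}_2$, $x_3^*\in\mathbb{R}^p$, $\lambda^*\in\mathbb{R}^p$ is an optimal primal and dual pair of $(P)$ if $f_i(x_i)-f_i(x_i^* )-(x_i-x_i^* )^\top A_i^\top\lambda^*\ge 0$ for all $x_i\in\mathcal{X}_i$, $i=1,2$; $\nabla f_3(x_3^* )-\lambda^*=0$; and $A_1x_1^*+A_2x_2^*+x_3^*=b$. The set of all such tuples is $\Omega^*$. 3-block ADMM for $(P)$ with penalty parameter $\gamma>0$: given $(x_2^k,x_3^k,\lambda^k)$, set $$x_1^{k+1}:=\operatorname{argmin}_{x_1\in\mathcal{X}_1}\ f_1(x_1)+\tfrac{\gamma}{2}\|A_1x_1+A_2x_2^k+x_3^k-b-\lambda^k/\gamma\|^2,$$ $$x_2^{k+1}:=\operatorname{argmin}_{x_2\in\mathcal{X}_2}\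 f_2(x_2)+\tfrac{\gamma}{2}\|A_1x_1^{k+1}+A_2x_2+x_3^k-b-\lambda^k/\gamma\|^2,$$ $$x_3^{k+1}:=\operatorname{argmin}_{x_3\in\mathbb{R}^p}\ f_3(x_3)+\tfrac{\gamma}{2}\|A_1x_1^{k+1}+A_2x_2^{k+1}+x_3-b-\lambda^k/\gamma\|^2,$$ $$\lambda^{k+1}:=\lambda^k-\gamma(A_1x_1^{k+1}+A_2x_2^{k+1}+x_3^{k+1}-b).$$ Local strong convexity (condition (ii)): for $i=1,2$ there exists $\sigma_i>0$ such that for every $(x_1^*,x_2^*,x_3^*,\lambda^* )\in\Omega^*$, $$f_i(x_i)-f_i(x_i^* )-(x_i-x_i^* )^\top g_i(x_i^* )\ge\frac{\sigma_i}{2}\|x_i-x_i^*\|^2\quad\forall x_i\in\mathcal{X}_i,$$ where $g_i(x_i^* )\in\partial f_i(x_i^* )$ is a subgradient of $f_i$ at $x_i^*$ realizing the optimality condition, i.e. $(x_i-x_i^* )^\top(g_i(x_i^* )-A_i^\top\lambda^* )\ge 0$ for all $x_i\in\mathcal{X}_i$. *)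

theory Defs
  imports "HOL-Analysis.Analysis"
begin

definition lower_semicont :: "('a::topological_space \<Rightarrow> real) \<Rightarrow> bool" where
  "lower_semicont f \<longleftrightarrow> (\<forall>x. \<forall>c < f x. \<forall>\<^sub>F y in nhds x. c < f y)"

text \<open>The gradient is meaningful at points of differentiability only.\<close>

definition gradient :: "('a::euclidean_space \<Rightarrow> real) \<Rightarrow> 'a \<Rightarrow> 'a" where
  "gradient f x = (THE D. GDERIV f x :> D)"

definition subdifferential :: "('a::real_inner \<Rightarrow> real) \<Rightarrow> 'a \<Rightarrow> 'a set" where
  "subdifferential f x = {g. \<forall>y. f y \<ge> f x + (y - x) \<bullet> g}"

definition strongly_convex :: "real \<Rightarrow> ('a::euclidean_space \<Rightarrow> real) \<Rightarrow> bool" where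
  "strongly_convex \<sigma> f \<longleftrightarrow>
     (\<forall>x y. f y \<ge> f x + (y - x) \<bullet> gradient f x + \<sigma> / 2 * (norm (y - x))\<^sup>2)"

text \<open>Unlike the library's \<open>indicator\<close>, this is the indicator function of convex analysis.\<close>

definition ind_fun :: "'a set \<Rightarrow> 'a \<Rightarrow> ereal" where
  "ind_fun X x = (if x \<in> X then 0 else \<infinity>)"

definition coercive :: "('a::real_normed_vector \<Rightarrow> ereal) \<Rightarrow> bool" where
  "coercive h \<longleftrightarrow> (h \<longlongrightarrow> \<infinity>) at_infinity"

definition full_column_rank :: "real^'n^'m \<Rightarrow> bool" where
  "full_column_rank A \<longleftrightarrow> rank A = CARD('n)"

text \<open>The block matrix \<open>[A B]\<close>.\<close>

definition hcat :: "real^'n1^'m \<Rightarrow> real^'n2^'m \<Rightarrow> real^('n1 + 'n2)^'m" where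
  "hcat A B = (\<chi> i j. case j of Inl k \<Rightarrow> A $ i $ k | Inr k \<Rightarrow> B $ i $ k)"

text \<open>The infimum is over the reals, so this is the optimal value only if the problem is feasible
  and bounded below; both hold whenever an optimal primal and dual pair exists.\<close>

definition opt_val ::
  "real^'n1^'p \<Rightarrow> real^'n2^'p \<Rightarrow> real^'p \<Rightarrow> (real^'n1) set \<Rightarrow> (real^'n2) set \<Rightarrow>
   (real^'n1 \<Rightarrow> real) \<Rightarrow> (real^'n2 \<Rightarrow> real) \<Rightarrow> (real^'p \<Rightarrow> real) \<Rightarrow> real" where
  "opt_val A1 A2 b X1 X2 f1 f2 f3 =
     Inf {f1 x1 + f2 x2 + f3 x3 | x1 x2 x3.
            x1 \<in> X1 \<and> x2 \<in> X2 \<and> A1 *v x1 + A2 *v x2 + x3 = b}"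

definition optimal_pairs ::
  "real^'n1^'p \<Rightarrow> real^'n2^'p \<Rightarrow> real^'p \<Rightarrow> (real^'n1) set \<Rightarrow> (real^'n2) set \<Rightarrow>
   (real^'n1 \<Rightarrow> real) \<Rightarrow> (real^'n2 \<Rightarrow> real) \<Rightarrow> (real^'p \<Rightarrow> real) \<Rightarrow>
   ((real^'n1) \<times> (real^'n2) \<times> (real^'p) \<times> (real^'p)) set" where
  "optimal_pairs A1 A2 b X1 X2 f1 f2 f3 =
     {(x1, x2, x3, l).
        x1 \<in> X1 \<and> x2 \<in> X2 \<and>
        (\<forall>y \<in> X1. f1 y - f1 x1 - (y - x1) \<bullet> (transpose A1 *v l) \<ge> 0) \<and>
        (\<forall>y \<in> X2. f2 y - f2 x2 - (y - x2) \<bullet> (transpose A2 *v l) \<ge> 0) \<and>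
        gradient f3 x3 - l = 0 \<and>
        A1 *v x1 + A2 *v x2 + x3 = b}"

text \<open>The starting point is unconstrained; in particular \<open>x1 0\<close> is irrelevant to later iterates.\<close>

definition admm3 ::
  "real^'n1^'p \<Rightarrow> real^'n2^'p \<Rightarrow> real^'p \<Rightarrow> (real^'n1) set \<Rightarrow> (real^'n2) set \<Rightarrow>
   (real^'n1 \<Rightarrow> real) \<Rightarrow> (real^'n2 \<Rightarrow> real) \<Rightarrow> (real^'p \<Rightarrow> real) \<Rightarrow> real \<Rightarrow>
   (nat \<Rightarrow> real^'n1) \<Rightarrow> (nat \<Rightarrow> real^'n2) \<Rightarrow> (nat \<Rightarrow> real^'p) \<Rightarrow> (nat \<Rightarrow> real^'p) \<Rightarrow> bool" where
  "admm3 A1 A2 b X1 X2 f1 f2 f3 \<gamma> x1 x2 x3 l \<longleftrightarrow>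
     (\<forall>k.
        is_arg_min
          (\<lambda>x. f1 x + \<gamma> / 2 * (norm (A1 *v x + A2 *v x2 k + x3 k - b - l k /\<^sub>R \<gamma>))\<^sup>2)
          (\<lambda>x. x \<in> X1) (x1 (Suc k)) \<and>
        is_arg_min
          (\<lambda>x. f2 x + \<gamma> / 2 * (norm (A1 *v x1 (Suc k) + A2 *v x + x3 k - b - l k /\<^sub>R \<gamma>))\<^sup>2)
          (\<lambda>x. x \<in> X2) (x2 (Suc k)) \<and>
        is_arg_min
          (\<lambda>x. f3 x + \<gamma> / 2 * (norm (A1 *v x1 (Suc k) + A2 *v x2 (Suc k) + x - b - l k /\<^sub>R \<gamma>))\<^sup>2)
          (\<lambda>x. True) (x3 (Suc k)) \<and>
        l (Suc k) = l k - \<gamma> *\<^sub>R (A1 *v x1 (Suc k) + A2 *v x2 (Suc k) + x3 (Suc k) - b))"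

text \<open>Local strong convexity of one block with data \<open>A\<close>, \<open>X\<close>, \<open>f\<close>; the set \<open>S\<close> collects the pairs
  consisting of this block's component and the multiplier of the optimal primal and dual pairs.
  The modulus is uniform over \<open>S\<close>, and the subgradient \<open>g\<close> must realize the optimality condition.\<close>

definition locally_strongly_convex ::
  "real^'n^'p \<Rightarrow> (real^'n) set \<Rightarrow> (real^'n \<Rightarrow> real) \<Rightarrow> ((real^'n) \<times> (real^'p)) set \<Rightarrow> bool" where
  "locally_strongly_convex A X f S \<longleftrightarrow>
     (\<exists>\<sigma> > 0. \<forall>(xs, l) \<in> S. \<exists>g \<in> subdifferential f xs.
        (\<forall>x \<in> X. (x - xs) \<bullet> (g - transpose A *v l) \<ge> 0) \<and>
        (\<forall>x \<in> X. f x - f xs - (x - xs) \<bullet> g \<ge> \<sigma> / 2 * (norm (x - xs))\<^sup>2))"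

definition seq_cluster_point :: "(nat \<Rightarrow> 'a::topological_space) \<Rightarrow> 'a \<Rightarrow> bool" where
  "seq_cluster_point z c \<longleftrightarrow> (\<exists>r. strict_mono r \<and> (z \<circ> r) \<longlonglongrightarrow> c)"

end

theory Submission
  imports Defs
begin

text \<open>For \<open>\<gamma> > L\<^sup>2 / \<sigma>\<close> the augmented Lagrangian decreases along the iteration, because
  \<open>l k = gradient f3 (x3 k)\<close> bounds the growth caused by a multiplier step by the step of \<open>x3\<close>.
  Strong convexity of \<open>f3\<close> and coercivity bound it from below, so the iterates are bounded, their
  increments vanish, and the variational inequalities pass to the limit. The optimal \<open>x3\<close> and \<open>\<lambda>\<close>
  are unique, and either extra condition makes the optimal \<open>x1\<close> and \<open>x2\<close> unique as well.

  Since \<open>\<eta>1, \<eta>2 > 2\<close>, both ranges of the second part lie in \<open>\<gamma> < 2 * \<sigma>\<close>, and this alone suffices.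
  The usual potential \<open>\<bar>\<lambda> - \<lambda>*\<bar>\<^sup>2 / (2 \<gamma>) + \<gamma>/2 \<bar>A2 (x2 - x2*)\<bar>\<^sup>2 + \<gamma>/2 \<bar>x3 - x3*\<bar>\<^sup>2\<close> minus the Bregman
  distance of \<open>f3\<close> from \<open>x3\<close> to \<open>x3*\<close> is decreasing: by the three-point identity the Bregman term
  absorbs \<open>(x3 - x3*) \<bullet> (l k - l (Suc k))\<close>, which no quadratic term controls. It still dominates the
  squared distances of \<open>A2 x2\<close> and \<open>x3\<close> to their limits, so a cluster point attracts the whole
  sequence.\<close>

section \<open>Sequences and matrices\<close>

text \<open>If convergence failed, some subsequence would keep \<open>F\<close> at distance at least
  \<open>e\<close> from \<open>v\<close>; boundedness gives it a convergent further subsequence,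
  whose limit is again a cluster point of \<open>z\<close>. Used with \<open>F\<close> the
  objective, whose value is common to all optimal pairs, and with \<open>F\<close> the identity when
  the optimal pair is unique.\<close>

lemma tendsto_of_unique_cluster_value:
  fixes z :: "nat \<Rightarrow> 'a::heine_borel" and F :: "'a \<Rightarrow> 'b::metric_space"
  assumes "bounded (range z)" and cont: "continuous_on UNIV F"
    and cluster: "\<And>c. seq_cluster_point z c \<Longrightarrow> F c = v"
  shows "(\<lambda>k. F (z k)) \<longlonglongrightarrow> v"
proof (rule ccontr)
  assume "\<not> (\<lambda>k. F (z k)) \<longlonglongrightarrow> v"
  then obtain e where "e > 0" and "\<not> (\<forall>\<^sub>F k in sequentially. dist (F (z k)) v < e)"
    unfolding tendsto_iff by blast
  then obtain r :: "nat \<Rightarrow> nat" where r: "strict_mono r" "\<And>n. \<not> dist (F (z (r n))) v < e"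
    using not_eventually_sequentiallyD by blast
  have "bounded (range (z \<circ> r))"
    by (rule bounded_subset[OF assms(1)]) auto
  then obtain c s where s: "strict_mono s" "((z \<circ> r) \<circ> s) \<longlonglongrightarrow> c"
    using bounded_imp_convergent_subsequence by blast
  then have "seq_cluster_point z c"
    unfolding seq_cluster_point_def using r(1) strict_mono_o by (metis comp_assoc)
  then have "F c = v" by (rule cluster)
  moreover have "(\<lambda>n. F (((z \<circ> r) \<circ> s) n)) \<longlonglongrightarrow> F c"
    using continuous_on_tendsto_compose[OF cont s(2)] by simp
  ultimately have "\<forall>\<^sub>F n in sequentially. dist (F (((z \<circ> r) \<circ> s) n)) v < e"
    using \<open>e > 0\<close> by (simp add: tendsto_iff)
  then show False using r(2) by simp
qed

text \<open>Here \<open>u\<close> is an energy and \<open>d\<close> its dissipation per step: the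
  consecutive differences of the convergent sequence \<open>u\<close> dominate \<open>d\<close> and
  tend to 0.\<close>

lemma nonincreasing_bounded_below:
  fixes u d :: "nat \<Rightarrow> real"
  assumes dec: "\<And>k. u (Suc k) + d k \<le> u k" and nonneg: "\<And>k. 0 \<le> d k"
    and lower: "\<And>k. m \<le> u k"
  shows "u k \<le> u 0" "convergent u" "d \<longlonglongrightarrow> 0"
proof -
  have mono: "decseq u"
    by (rule decseq_SucI) (metis dec nonneg add_increasing2 order_refl order_trans)
  then show "u k \<le> u 0" by (simp add: decseq_def)
  obtain w where "u \<longlonglongrightarrow> w"
    using decseq_convergent[OF mono, of m] lower by blast
  then show "convergent u" by (rule convergentI)
  have "(\<lambda>k. u k - u (Suc k)) \<longlonglongrightarrow> w - w"
    using \<open>u \<longlonglongrightarrow> w\<close> by (intro tendsto_diff LIMSEQ_Suc)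
  then have "(\<lambda>k. u k - u (Suc k)) \<longlonglongrightarrow> 0" by simp
  then show "d \<longlonglongrightarrow> 0"
    by (rule tendsto_sandwich[OF _ _ tendsto_const, rotated 2])
       (use nonneg dec in \<open>auto simp: le_diff_eq add.commute\<close>)
qed

lemma tendsto_zero_of_power2:
  fixes u :: "nat \<Rightarrow> 'a::real_normed_vector"
  assumes "d \<longlonglongrightarrow> 0" "C > 0" "\<And>k. C * (norm (u k))\<^sup>2 \<le> d k"
  shows "u \<longlonglongrightarrow> 0"
proof -
  have "(\<lambda>k. d k / C) \<longlonglongrightarrow> 0"
    using tendsto_divide[OF assms(1) tendsto_const[of C]] assms(2) by simp
  then have "(\<lambda>k. (norm (u k))\<^sup>2) \<longlonglongrightarrow> 0"
    by (rule tendsto_sandwich[OF _ _ tendsto_const, rotated 2])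
       (use assms(2,3) in \<open>auto simp: field_simps\<close>)
  then have "(\<lambda>k. sqrt ((norm (u k))\<^sup>2)) \<longlonglongrightarrow> sqrt 0" by (rule tendsto_real_sqrt)
  then show ?thesis by (simp add: tendsto_norm_zero_iff)
qed

section \<open>Matrices of full column rank\<close>

text \<open>The energies control only the images under \<open>A1\<close> and \<open>A2\<close>; an
  injective linear map in finite dimension is bounded below, which carries the control back to the
  variables.\<close>

lemma full_column_rank_lower_bound:
  fixes A :: "real^'n^'m"
  assumes "full_column_rank A"
  obtains C where "C > 0" "\<And>x. C * norm x \<le> norm (A *v x)"
proof -
  have "inj ((*v) A)"
    using assms by (simp add: full_column_rank_def full_rank_injective)
  then obtain C where "C > 0" "\<And>x. norm (A *v x) \<ge> C * norm x"
    using linear_inj_bounded_below_pos[OF matrix_vector_mul_linear[of A]] by blast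
  then show ?thesis using that by blast
qed

lemma full_column_rank_bounded:
  fixes A :: "real^'n^'m"
  assumes "full_column_rank A" "bounded (range (\<lambda>k. A *v x k))"
  shows "bounded (range x)"
proof -
  obtain C where C: "C > 0" "\<And>x. C * norm x \<le> norm (A *v x)"
    using full_column_rank_lower_bound[OF assms(1)] by blast
  obtain M where M: "\<And>k. norm (A *v x k) \<le> M"
    using assms(2) by (auto simp: bounded_iff)
  have "norm (x k) \<le> M / C" for k
    using order_trans[OF C(2) M, of k] C(1) by (simp add: field_simps)
  then show ?thesis by (auto simp: bounded_iff)
qed

lemma full_column_rank_tendsto:
  fixes A :: "real^'n^'m"
  assumes "full_column_rank A" "(\<lambda>k. A *v x k) \<longlonglongrightarrow> A *v u"
  shows "x \<longlonglongrightarrow> u"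
proof -
  obtain C where C: "C > 0" "\<And>x. C * norm x \<le> norm (A *v x)"
    using full_column_rank_lower_bound[OF assms(1)] by blast
  have "(\<lambda>k. norm (A *v x k - A *v u)) \<longlonglongrightarrow> 0"
    using assms(2) by (simp add: LIM_zero_iff tendsto_norm_zero_iff)
  then have "(\<lambda>k. norm (A *v x k - A *v u) / C) \<longlonglongrightarrow> 0"
    using tendsto_divide[OF _ tendsto_const[of C]] C(1) by fastforce
  then have "(\<lambda>k. norm (x k - u)) \<longlonglongrightarrow> 0"
    by (rule tendsto_sandwich[OF _ _ tendsto_const, rotated 2])
       (use C(1) C(2)[of "x _ - u"] in \<open>auto simp: field_simps matrix_vector_mult_diff_distrib\<close>)
  then show ?thesis using LIM_zero_iff tendsto_norm_zero_iff by blast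
qed

lemma full_column_rank_eqD:
  fixes A :: "real^'n^'m"
  assumes "full_column_rank A" "A *v x = A *v y"
  shows "x = y"
  using assms by (auto simp: full_column_rank_def full_rank_injective dest: injD)

lemma hcat_mult_vector:
  "hcat A B *v (\<chi> j. case j of Inl k \<Rightarrow> x $ k | Inr k \<Rightarrow> y $ k) = A *v x + B *v y"
  unfolding matrix_vector_mult_def hcat_def vec_eq_iff
  \<comment> \<open>The sum over the disjoint union of the column indices splits into the two block
    sums.\<close>
  by (simp add: UNIV_Plus_UNIV[symmetric] sum.Plus del: UNIV_Plus_UNIV)

lemma full_column_rank_hcat_eqD:
  fixes A :: "real^'n^'m" and B :: "real^'k^'m"
  assumes "full_column_rank (hcat A B)" "A *v x + B *v y = A *v x' + B *v y'"
  shows "x = x'" "y = y'"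
proof -
  have eq: "(\<chi> j. case j of Inl k \<Rightarrow> x $ k | Inr k \<Rightarrow> y $ k)
      = ((\<chi> j. case j of Inl k \<Rightarrow> x' $ k | Inr k \<Rightarrow> y' $ k) :: real^('n + 'k))"
    using assms by (intro full_column_rank_eqD[OF assms(1)]) (simp add: hcat_mult_vector)
  then have *: "(case j of Inl k \<Rightarrow> x $ k | Inr k \<Rightarrow> y $ k) = (case j of Inl k \<Rightarrow> x' $ k | Inr k \<Rightarrow> y' $ k)" for j
    by (simp add: vec_eq_iff)
  show "x = x'"
    using *[of "Inl _"] by (simp add: vec_eq_iff)
  show "y = y'"
    using *[of "Inr _"] by (simp add: vec_eq_iff)
qed

section \<open>Convex functions and minimizers\<close>

text \<open>Makes the definite description in \<open>gradient\<close> usable: by Riesz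
  representation a derivative is the inner product with exactly one vector.\<close>

lemma GDERIV_gradient:
  fixes f :: "'a::euclidean_space \<Rightarrow> real"
  assumes "f differentiable (at x)"
  shows "GDERIV f x :> gradient f x"
proof -
  obtain f' where f': "(f has_derivative f') (at x)"
    using assms by (auto simp: differentiable_def)
  \<comment> \<open>\<open>adjoint f' 1\<close> is the Riesz vector, because \<open>f' h\<close>
    equals its real inner product with 1.\<close>
  have "f' = (\<lambda>h. h \<bullet> adjoint f' 1)"
    using adjoint_works[OF has_derivative_linear[OF f'], of _ 1] by auto
  then have D: "GDERIV f x :> adjoint f' 1"
    using f' by (simp add: gderiv_def)
  moreover have "E = adjoint f' 1" if "GDERIV f x :> E" for E
  proof -
    have "(\<lambda>h. h \<bullet> E) = (\<lambda>h. h \<bullet> adjoint f' 1)"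
      using D that unfolding gderiv_def by (rule has_derivative_unique[rotated])
    then show ?thesis by (metis vector_eq_rdot inner_commute)
  qed
  ultimately show ?thesis unfolding gradient_def by (rule theI)
qed

lemma strongly_convexD:
  "strongly_convex \<sigma> f \<Longrightarrow> f x + (y - x) \<bullet> gradient f x + \<sigma> / 2 * (norm (y - x))\<^sup>2 \<le> f y"
  by (simp add: strongly_convex_def)

lemma strongly_convex_gradient_monotone:
  assumes "strongly_convex \<sigma> f"
  shows "\<sigma> * (norm (y - x))\<^sup>2 \<le> (y - x) \<bullet> (gradient f y - gradient f x)"
  using strongly_convexD[OF assms, of x y] strongly_convexD[OF assms, of y x]
  by (simp add: inner_simps norm_minus_commute)

lemma nonneg_of_linear_perturbation:
  fixes B C :: real
  assumes "\<And>t. 0 < t \<Longrightarrow> t \<le> 1 \<Longrightarrow> 0 \<le> B + t * C"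
  shows "0 \<le> B"
proof (rule tendsto_lowerbound)
  show "((\<lambda>t. B + t * C) \<longlongrightarrow> B) (at_right 0)"
    by (auto intro!: tendsto_eq_intros)
  show "\<forall>\<^sub>F t in at_right 0. 0 \<le> B + t * C"
    by (rule eventually_at_rightI[of 0 1]) (auto intro: assms)
qed simp

text \<open>A first-order condition that needs no derivative of \<open>f\<close>: compare
  \<open>u\<close> with \<open>u + t *\<^sub>R (y - u)\<close>, bound \<open>f\<close> there by
  convexity, expand the square exactly, divide by \<open>t\<close> and let \<open>t\<close> tend to
  0. The affine map \<open>G\<close> with linear part \<open>B\<close> covers both constrained
  subproblems.\<close>

lemma is_arg_min_variational_inequality:
  fixes f :: "'a::real_vector \<Rightarrow> real" and B :: "'a \<Rightarrow> 'b::real_inner"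
  assumes "convex X" "convex_on UNIV f" "linear B"
    and G: "\<And>x y. G y - G x = B (y - x)"
    and min: "is_arg_min (\<lambda>x. f x + \<gamma> / 2 * (norm (G x))\<^sup>2) (\<lambda>x. x \<in> X) u"
    and "y \<in> X"
  shows "0 \<le> f y - f u + \<gamma> * (B (y - u) \<bullet> G u)"
proof (rule nonneg_of_linear_perturbation)
  fix t :: real assume t: "0 < t" "t \<le> 1"
  define x where "x = u + t *\<^sub>R (y - u)"
  have x: "x = (1 - t) *\<^sub>R u + t *\<^sub>R y" by (simp add: x_def algebra_simps)
  have "u \<in> X" using min by (simp add: is_arg_min_def)
  then have "x \<in> X"
    using \<open>convex X\<close> \<open>y \<in> X\<close> t unfolding x convex_alt by simp
  then have "f u + \<gamma> / 2 * (norm (G u))\<^sup>2 \<le> f x + \<gamma> / 2 * (norm (G x))\<^sup>2"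
    using min by (simp add: is_arg_min_linorder)
  moreover have "f x \<le> (1 - t) * f u + t * f y"
    unfolding x using convex_onD[OF assms(2), of t u y] t by simp
  moreover have "G x = G u + t *\<^sub>R B (y - u)"
    using G[of x u] linear_cmul[OF assms(3), of t "y - u"]
    by (simp only: x_def add_diff_cancel_left' diff_eq_eq add.commute)
  then have "(norm (G x))\<^sup>2 = (norm (G u))\<^sup>2 + 2 * t * (B (y - u) \<bullet> G u) + t\<^sup>2 * (norm (B (y - u)))\<^sup>2"
    unfolding power2_norm_eq_inner
    by (simp add: inner_simps inner_commute power2_eq_square algebra_simps)
  ultimately have "0 \<le> t * (f y - f u + \<gamma> * (B (y - u) \<bullet> G u) + t * (\<gamma> / 2 * (norm (B (y - u)))\<^sup>2))"
    by (simp add: algebra_simps power2_eq_square add_divide_distrib)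
  then show "0 \<le> f y - f u + \<gamma> * (B (y - u) \<bullet> G u) + t * (\<gamma> / 2 * (norm (B (y - u)))\<^sup>2)"
    using t(1) by (simp add: zero_le_mult_iff)
qed

lemma is_arg_min_gradient:
  fixes f :: "'a::euclidean_space \<Rightarrow> real"
  assumes "f differentiable (at u)"
    and min: "is_arg_min (\<lambda>x. f x + \<gamma> / 2 * (norm (x + q))\<^sup>2) (\<lambda>x. True) u"
  shows "gradient f u = - \<gamma> *\<^sub>R (u + q)"
proof -
  let ?D = "\<lambda>h. h \<bullet> gradient f u + \<gamma> * (h \<bullet> (u + q))"
  have "((\<lambda>x. f x + \<gamma> / 2 * ((x + q) \<bullet> (x + q))) has_derivative ?D) (at u)"
    by (rule derivative_eq_intros GDERIV_gradient[OF assms(1), unfolded gderiv_def] refl)+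
       (auto simp: fun_eq_iff inner_commute algebra_simps)
  moreover have "\<forall>\<^sub>F y in at u. f u + \<gamma> / 2 * ((u + q) \<bullet> (u + q)) \<le> f y + \<gamma> / 2 * ((y + q) \<bullet> (y + q))"
    using min by (simp add: is_arg_min_linorder power2_norm_eq_inner)
  ultimately have "?D = (\<lambda>h. 0)" by (rule has_derivative_local_min)
  then have "h \<bullet> (gradient f u + \<gamma> *\<^sub>R (u + q)) = 0" for h
    by (metis inner_add_right inner_scaleR_right)
  then have "gradient f u + \<gamma> *\<^sub>R (u + q) = 0"
    using inner_eq_zero_iff by blast
  then show ?thesis by (simp add: add_eq_0_iff)
qed

lemma coercive_sublevel_bounded:
  fixes f :: "'a::real_normed_vector \<Rightarrow> real"
  assumes "coercive (\<lambda>x. ereal (f x) + ind_fun X x)"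
  shows "bounded {x \<in> X. f x \<le> c}"
proof -
  have "\<forall>\<^sub>F x in at_infinity. ereal c < ereal (f x) + ind_fun X x"
    using assms unfolding coercive_def by (rule order_tendstoD) simp
  then obtain M where M: "\<And>x. M \<le> norm x \<Longrightarrow> ereal c < ereal (f x) + ind_fun X x"
    by (auto simp: eventually_at_infinity)
  have "norm x \<le> M" if "x \<in> X" "f x \<le> c" for x
    using M[of x] that by (fastforce simp: ind_fun_def)
  then show ?thesis by (auto simp: bounded_iff)
qed

text \<open>Outside the sublevel set of \<open>f u\<close> the values exceed \<open>f u\<close>, and
  on this compact set \<open>f\<close> attains a minimum, which is therefore a minimum over
  \<open>X\<close>.\<close>

lemma coercive_bdd_below:
  fixes f :: "'a::heine_borel \<Rightarrow> real"
  assumes "bounded {x \<in> X. f x \<le> f u}" "closed X" "continuous_on UNIV f" "u \<in> X"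
  shows "bdd_below (f ` X)"
proof -
  let ?S = "{x \<in> X. f x \<le> f u}"
  have "closed ?S"
    using assms(2,3) by (intro closed_Collect_conj closed_Collect_le) auto
  then have "compact ?S" using assms(1) by (simp add: compact_eq_bounded_closed)
  moreover have "?S \<noteq> {}" using assms(4) by blast
  ultimately have "\<exists>v\<in>?S. \<forall>x\<in>?S. f v \<le> f x"
    by (rule continuous_attains_inf) (rule continuous_on_subset[OF assms(3) subset_UNIV])
  then obtain v where v: "v \<in> ?S" "\<forall>x\<in>?S. f v \<le> f x" ..
  have "f v \<le> f x" if "x \<in> X" for x
    using v that by (cases "f x \<le> f u") auto
  then show ?thesis by (intro bdd_belowI2)
qed

section \<open>Optimal primal and dual pairs\<close>

lemma inner_transpose_matrix_vector:
  fixes A :: "real^'n^'m"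
  shows "(y - x) \<bullet> (transpose A *v m) = (A *v y - A *v x) \<bullet> m"
  by (metis dot_lmul_matrix inner_commute matrix_vector_mult_diff_distrib transpose_matrix_vector)

text \<open>Moving the transposes across the inner product leaves only the images under
  \<open>A1\<close> and \<open>A2\<close>, the quantities in which all energy estimates are
  written.\<close>

lemma optimal_pairs_iff:
  "(y1, y2, y3, m) \<in> optimal_pairs A1 A2 b X1 X2 f1 f2 f3 \<longleftrightarrow>
     y1 \<in> X1 \<and> y2 \<in> X2 \<and>
     (\<forall>x \<in> X1. (A1 *v x - A1 *v y1) \<bullet> m \<le> f1 x - f1 y1) \<and>
     (\<forall>x \<in> X2. (A2 *v x - A2 *v y2) \<bullet> m \<le> f2 x - f2 y2) \<and>
     gradient f3 y3 = m \<and> A1 *v y1 + A2 *v y2 + y3 = b"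
  unfolding optimal_pairs_def
  by (auto simp: inner_transpose_matrix_vector simp del: transpose_matrix_vector)

text \<open>The multiplier gives a linear lower bound for each of the three blocks. In their sum the
  linear terms combine to the difference of two constraint values, which vanishes by
  feasibility.\<close>

lemma optimal_pairs_opt_val:
  assumes "(y1, y2, y3, m) \<in> optimal_pairs A1 A2 b X1 X2 f1 f2 f3"
    and "strongly_convex \<sigma> f3" "\<sigma> > 0"
  shows "opt_val A1 A2 b X1 X2 f1 f2 f3 = f1 y1 + f2 y2 + f3 y3"
  unfolding opt_val_def
proof (rule cInf_eq_minimum)
  note y = assms(1)[unfolded optimal_pairs_iff]
  show "f1 y1 + f2 y2 + f3 y3 \<in> {f1 x1 + f2 x2 + f3 x3 | x1 x2 x3.
      x1 \<in> X1 \<and> x2 \<in> X2 \<and> A1 *v x1 + A2 *v x2 + x3 = b}"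
    using y by blast
  fix v assume "v \<in> {f1 x1 + f2 x2 + f3 x3 | x1 x2 x3.
      x1 \<in> X1 \<and> x2 \<in> X2 \<and> A1 *v x1 + A2 *v x2 + x3 = b}"
  then obtain x1 x2 x3 where x: "v = f1 x1 + f2 x2 + f3 x3" "x1 \<in> X1" "x2 \<in> X2"
    "A1 *v x1 + A2 *v x2 + x3 = b" by blast
  have "(x3 - y3) \<bullet> m \<le> f3 x3 - f3 y3"
  proof -
    have "f3 y3 + (x3 - y3) \<bullet> m + \<sigma> / 2 * (norm (x3 - y3))\<^sup>2 \<le> f3 x3"
      using strongly_convexD[OF assms(2), of y3 x3] y by simp
    moreover have "0 \<le> \<sigma> / 2 * (norm (x3 - y3))\<^sup>2" using assms(3) by simp
    ultimately show ?thesis by linarith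
  qed
  moreover have "(A1 *v x1 - A1 *v y1) \<bullet> m \<le> f1 x1 - f1 y1" "(A2 *v x2 - A2 *v y2) \<bullet> m \<le> f2 x2 - f2 y2"
    using y x by blast+
  moreover have "(A1 *v x1 - A1 *v y1) \<bullet> m + (A2 *v x2 - A2 *v y2) \<bullet> m + (x3 - y3) \<bullet> m
      = ((A1 *v x1 + A2 *v x2 + x3) - (A1 *v y1 + A2 *v y2 + y3)) \<bullet> m"
    by (simp add: inner_simps)
  moreover have "\<dots> = 0" using x y by simp
  ultimately show "f1 y1 + f2 y2 + f3 y3 \<le> v" using x(1) by linarith
qed

text \<open>Testing each pair's inequalities at the other pair and adding makes
  \<open>(v3 - u3) \<bullet> (n - m)\<close> nonpositive, whereas strong monotonicity of the
  gradient bounds it below by a multiple of the squared distance.\<close>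

lemma optimal_pairs_third_unique:
  assumes u: "(u1, u2, u3, m) \<in> optimal_pairs A1 A2 b X1 X2 f1 f2 f3"
    and v: "(v1, v2, v3, n) \<in> optimal_pairs A1 A2 b X1 X2 f1 f2 f3"
    and "strongly_convex \<sigma> f3" "\<sigma> > 0"
  shows "u3 = v3" "m = n" "A1 *v u1 + A2 *v u2 = A1 *v v1 + A2 *v v2"
proof -
  note u = u[unfolded optimal_pairs_iff] and v = v[unfolded optimal_pairs_iff]
  have "(A1 *v v1 - A1 *v u1) \<bullet> m + (A1 *v u1 - A1 *v v1) \<bullet> n \<le> 0"
    "(A2 *v v2 - A2 *v u2) \<bullet> m + (A2 *v u2 - A2 *v v2) \<bullet> n \<le> 0"
    using u v by fastforce+
  moreover have "A1 *v u1 + A2 *v u2 = b - u3" "A1 *v v1 + A2 *v v2 = b - v3"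
    using u v by (auto simp: eq_diff_eq)
  then have "(A1 *v u1 + A2 *v u2) \<bullet> (m - n) = (b - u3) \<bullet> (m - n)"
    "(A1 *v v1 + A2 *v v2) \<bullet> (m - n) = (b - v3) \<bullet> (m - n)" by simp_all
  ultimately have "(v3 - u3) \<bullet> (n - m) \<le> 0"
    by (simp add: inner_simps)
  moreover have "\<sigma> * (norm (v3 - u3))\<^sup>2 \<le> (v3 - u3) \<bullet> (n - m)"
    using strongly_convex_gradient_monotone[OF assms(3), of v3 u3] u v by simp
  ultimately have "\<sigma> * (norm (v3 - u3))\<^sup>2 \<le> 0" by linarith
  then have "(norm (v3 - u3))\<^sup>2 \<le> 0" using assms(4) by (simp add: mult_le_0_iff)
  then show "u3 = v3" by simp
  then show "m = n" "A1 *v u1 + A2 *v u2 = A1 *v v1 + A2 *v v2"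
    using u v by (auto simp: algebra_simps)
qed

text \<open>The growth condition at \<open>u\<close> and the optimality of \<open>v\<close> for the
  same multiplier add up to a nonpositive bound on the squared distance, as the function values and
  the multiplier terms cancel.\<close>

lemma locally_strongly_convex_unique:
  assumes "locally_strongly_convex A X f S" "(u, m) \<in> S" "u \<in> X" "v \<in> X"
    and opt: "\<And>x. x \<in> X \<Longrightarrow> (A *v x - A *v v) \<bullet> m \<le> f x - f v"
  shows "u = v"
proof -
  obtain s g where s: "s > 0"
    and g: "\<forall>x \<in> X. (x - u) \<bullet> (g - transpose A *v m) \<ge> 0"
      "\<forall>x \<in> X. f x - f u - (x - u) \<bullet> g \<ge> s / 2 * (norm (x - u))\<^sup>2"
    using assms(1,2) unfolding locally_strongly_convex_def by fast
  have "(v - u) \<bullet> (transpose A *v m) \<le> (v - u) \<bullet> g"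
    using g(1) \<open>v \<in> X\<close> by (simp add: inner_diff_right)
  then have "(A *v v - A *v u) \<bullet> m \<le> (v - u) \<bullet> g"
    by (simp only: inner_transpose_matrix_vector)
  moreover have "s / 2 * (norm (v - u))\<^sup>2 \<le> f v - f u - (v - u) \<bullet> g" using g(2) \<open>v \<in> X\<close> by blast
  moreover have "(A *v u - A *v v) \<bullet> m \<le> f u - f v" using opt \<open>u \<in> X\<close> .
  ultimately have "s / 2 * (norm (v - u))\<^sup>2 \<le> 0" by (simp add: inner_simps)
  then have "(norm (v - u))\<^sup>2 \<le> 0" using s by (simp add: mult_le_0_iff)
  then show ?thesis by simp
qed

section \<open>The two energy inequalities\<close>

text \<open>Here \<open>p\<close>, \<open>q\<close>, \<open>s\<close> are the steps, old minus new,
  of \<open>A1 x1\<close>, \<open>A2 x2\<close>, \<open>x3\<close>; \<open>D1\<close>,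
  \<open>D2\<close>, \<open>D3\<close> are the decreases of the functions; \<open>m\<close> is the
  old multiplier and \<open>r\<close> the new residual, so \<open>p + q + s + r\<close> is the old
  residual. The cross terms of its square cancel against those of the hypotheses, and the multiplier
  step leaves the only negative term, the one in \<open>r\<close>.\<close>

lemma augmented_Lagrangian_decrease:
  fixes p q s r m :: "'a::real_inner"
  assumes "0 \<le> D1 + p \<bullet> (\<gamma> *\<^sub>R (q + s + r) - m)" "0 \<le> D2 + q \<bullet> (\<gamma> *\<^sub>R (s + r) - m)"
    "\<sigma> / 2 * (norm s)\<^sup>2 \<le> D3 - s \<bullet> (m - \<gamma> *\<^sub>R r)"
  shows "\<gamma> / 2 * (norm p)\<^sup>2 + \<gamma> / 2 * (norm q)\<^sup>2 + (\<sigma> + \<gamma>) / 2 * (norm s)\<^sup>2 - \<gamma> * (norm r)\<^sup>2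
    \<le> D1 + D2 + D3 - m \<bullet> (p + q + s + r) + \<gamma> / 2 * (norm (p + q + s + r))\<^sup>2
       + (m - \<gamma> *\<^sub>R r) \<bullet> r - \<gamma> / 2 * (norm r)\<^sup>2"
  using assms unfolding power2_norm_eq_inner
  by (simp add: inner_simps inner_commute algebra_simps add_divide_distrib)

text \<open>Here \<open>a\<close>, \<open>v\<close>, \<open>w\<close>, \<open>\<mu>\<close> are the deviations of \<open>A1 x1\<close>, \<open>A2 x2\<close>, \<open>x3\<close>, \<open>\<lambda>\<close> from an optimal
  pair, the subscript \<open>0\<close> marks the preceding iterate, and \<open>m\<close> is the optimal multiplier. The
  subtracted terms are Bregman distances of \<open>f3\<close>.\<close>

lemma lyapunov_decrease:
  fixes a v w v0 w0 \<mu> \<mu>0 m :: "'a::real_inner"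
  assumes "\<gamma> > 0" and \<mu>0: "\<mu>0 = \<mu> + \<gamma> *\<^sub>R (a + v + w)"
    and "0 \<le> a \<bullet> (\<mu> - \<gamma> *\<^sub>R (v0 - v) - \<gamma> *\<^sub>R (w0 - w))" "0 \<le> v \<bullet> (\<mu> - \<gamma> *\<^sub>R (w0 - w))"
    and "\<sigma> * (norm w)\<^sup>2 \<le> w \<bullet> \<mu>" "0 \<le> \<phi>0 - \<phi> - (\<mu> + m) \<bullet> (w0 - w)"
  shows "(norm \<mu>)\<^sup>2 / (2 * \<gamma>) + \<gamma> / 2 * (norm v)\<^sup>2 + \<gamma> / 2 * (norm w)\<^sup>2 - (c - \<phi> + (\<mu> + m) \<bullet> w)
      + ((\<sigma> - \<gamma> / 2) * (norm w)\<^sup>2 + \<gamma> / 2 * (norm (a + v0))\<^sup>2 + \<gamma> / 2 * (norm (w0 - w))\<^sup>2)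
    \<le> (norm \<mu>0)\<^sup>2 / (2 * \<gamma>) + \<gamma> / 2 * (norm v0)\<^sup>2 + \<gamma> / 2 * (norm w0)\<^sup>2 - (c - \<phi>0 + (\<mu>0 + m) \<bullet> w0)"
proof -
  have "(norm (\<mu> + \<gamma> *\<^sub>R r))\<^sup>2 / (2 * \<gamma>) = (norm \<mu>)\<^sup>2 / (2 * \<gamma>) + \<mu> \<bullet> r + \<gamma> / 2 * (norm r)\<^sup>2" for r
    using \<open>\<gamma> > 0\<close> unfolding power2_norm_eq_inner
    by (simp add: inner_simps inner_commute field_simps)
  then have "(norm \<mu>0)\<^sup>2 / (2 * \<gamma>)
      = (norm \<mu>)\<^sup>2 / (2 * \<gamma>) + \<mu> \<bullet> (a + v + w) + \<gamma> / 2 * (norm (a + v + w))\<^sup>2"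
    by (simp only: \<mu>0)
  moreover have "\<mu>0 \<bullet> w0 = \<mu> \<bullet> w0 + \<gamma> * ((a + v + w) \<bullet> w0)"
    by (simp add: \<mu>0 inner_simps)
  \<comment> \<open>On adding the hypotheses, the products of \<open>a + v\<close> with
    \<open>w0\<close> and with \<open>w\<close> cancel. The rest completes the squares of
    \<open>a + v0\<close> and \<open>w0 - w\<close>, up to a deficit
    \<open>\<gamma> / 2 * (norm w)\<^sup>2\<close> that is charged to strong monotonicity: this is
    the source of \<open>\<gamma> < 2 * \<sigma>\<close>.\<close>
  ultimately show ?thesis
    using assms(3-) unfolding power2_norm_eq_inner
    by (simp add: inner_simps inner_commute algebra_simps add_divide_distrib)
qed

text \<open>The terms in \<open>\<mu>\<close> and the square of \<open>w\<close> form the perfect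
  square of \<open>\<mu> - \<gamma> *\<^sub>R w\<close>. What remains of the subtracted term is the
  Bregman distance taken at the optimal point, which the hypothesis bounds below.\<close>

lemma lyapunov_lower_bound:
  fixes v w \<mu> m :: "'a::real_inner"
  assumes "\<gamma> > 0" "\<sigma> / 2 * (norm w)\<^sup>2 \<le> \<phi> - c - w \<bullet> m"
  shows "\<gamma> / 2 * (norm v)\<^sup>2 + \<sigma> / 2 * (norm w)\<^sup>2
    \<le> (norm \<mu>)\<^sup>2 / (2 * \<gamma>) + \<gamma> / 2 * (norm v)\<^sup>2 + \<gamma> / 2 * (norm w)\<^sup>2 - (c - \<phi> + (\<mu> + m) \<bullet> w)"
proof -
  have "0 \<le> (norm (\<mu> - \<gamma> *\<^sub>R w))\<^sup>2 / (2 * \<gamma>)" using assms(1) by simp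
  also have "\<dots> = (norm \<mu>)\<^sup>2 / (2 * \<gamma>) - \<mu> \<bullet> w + \<gamma> / 2 * (norm w)\<^sup>2"
    using assms(1) unfolding power2_norm_eq_inner
    by (simp add: inner_simps inner_commute field_simps)
  finally show ?thesis using assms(2) by (simp add: inner_simps inner_commute)
qed

section \<open>The iteration\<close>

text \<open>The subproblems say something about indices from 1 on only, since the starting point is
  arbitrary; this adds index 0.\<close>

lemma bounded_range_Suc:
  fixes u :: "nat \<Rightarrow> 'a::metric_space"
  assumes "bounded (range (\<lambda>k. u (Suc k)))"
  shows "bounded (range u)"
proof -
  have "u k \<in> insert (u 0) (range (\<lambda>k. u (Suc k)))" for k by (cases k) auto
  then have "range u \<subseteq> insert (u 0) (range (\<lambda>k. u (Suc k)))" by blast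
  then show ?thesis using assms bounded_subset bounded_insert by metis
qed

locale three_block_admm =
  fixes A1 :: "real^'n1^'p" and A2 :: "real^'n2^'p" and b :: "real^'p"
    and X1 :: "(real^'n1) set" and X2 :: "(real^'n2) set"
    and f1 :: "real^'n1 \<Rightarrow> real" and f2 :: "real^'n2 \<Rightarrow> real" and f3 :: "real^'p \<Rightarrow> real"
    and \<sigma> L \<gamma> :: real
    and x1 :: "nat \<Rightarrow> real^'n1" and x2 :: "nat \<Rightarrow> real^'n2" and x3 l :: "nat \<Rightarrow> real^'p"
  assumes closed_X1: "closed X1" and convex_X1: "convex X1"
    and closed_X2: "closed X2" and convex_X2: "convex X2"
    and convex_f1: "convex_on UNIV f1" and convex_f2: "convex_on UNIV f2"
    and differentiable_f3: "f3 differentiable (at x)"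
    and sigma_pos: "\<sigma> > 0" and strongly_convex_f3: "strongly_convex \<sigma> f3"
    and lipschitz: "L-lipschitz_on UNIV (gradient f3)"
    and rank_A1: "full_column_rank A1" and rank_A2: "full_column_rank A2"
    and gamma_pos: "\<gamma> > 0"
    and iterates: "admm3 A1 A2 b X1 X2 f1 f2 f3 \<gamma> x1 x2 x3 l"
    and optimal_pairs_nonempty: "optimal_pairs A1 A2 b X1 X2 f1 f2 f3 \<noteq> {}"
begin

abbreviation \<Omega> :: "((real^'n1) \<times> (real^'n2) \<times> (real^'p) \<times> (real^'p)) set" where
  "\<Omega> \<equiv> optimal_pairs A1 A2 b X1 X2 f1 f2 f3"

definition z :: "nat \<Rightarrow> (real^'n1) \<times> (real^'n2) \<times> (real^'p) \<times> (real^'p)" where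
  "z k = (x1 k, x2 k, x3 k, l k)"

definition residual :: "nat \<Rightarrow> real^'p" where
  "residual k = A1 *v x1 k + A2 *v x2 k + x3 k - b"

section \<open>Optimality conditions satisfied by the iterates\<close>

lemma multiplier_Suc: "l (Suc k) = l k - \<gamma> *\<^sub>R residual (Suc k)"
  using iterates by (simp add: admm3_def residual_def)

lemma x1_mem: "x1 (Suc k) \<in> X1" and x2_mem: "x2 (Suc k) \<in> X2"
  using iterates by (simp_all add: admm3_def is_arg_min_def)

text \<open>The third block enters the constraint through the identity, so the multiplier update
  absorbs the penalty term of its stationarity condition. From index 1 on the multiplier is thus a
  Lipschitz function of \<open>x3\<close>.\<close>

lemma gradient_x3: "gradient f3 (x3 (Suc k)) = l (Suc k)"
proof -
  have "is_arg_min (\<lambda>x. f3 x + \<gamma> / 2 *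
      (norm (x + (A1 *v x1 (Suc k) + A2 *v x2 (Suc k) - b - l k /\<^sub>R \<gamma>)))\<^sup>2)
      (\<lambda>x. True) (x3 (Suc k))"
    using iterates by (simp add: admm3_def algebra_simps)
  from is_arg_min_gradient[OF differentiable_f3 this]
  have "gradient f3 (x3 (Suc k)) = - \<gamma> *\<^sub>R (residual (Suc k) - l k /\<^sub>R \<gamma>)"
    by (simp add: residual_def algebra_simps)
  then show ?thesis using gamma_pos by (simp add: multiplier_Suc scaleR_diff_right)
qed

text \<open>Expressing the old multiplier through the new one turns the subproblem's condition into
  the optimality condition at the new iterate, up to increments of the blocks that were still
  old.\<close>

lemma variational_inequality_x1:
  assumes "y \<in> X1"
  shows "0 \<le> f1 y - f1 (x1 (Suc k)) + (A1 *v y - A1 *v x1 (Suc k)) \<bullet>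
    (\<gamma> *\<^sub>R (A2 *v x2 k - A2 *v x2 (Suc k)) + \<gamma> *\<^sub>R (x3 k - x3 (Suc k)) - l (Suc k))"
proof -
  let ?G = "\<lambda>x. A1 *v x + A2 *v x2 k + x3 k - b - l k /\<^sub>R \<gamma>"
  have "0 \<le> f1 y - f1 (x1 (Suc k)) + \<gamma> * ((A1 *v (y - x1 (Suc k))) \<bullet> ?G (x1 (Suc k)))"
    using iterates by (intro is_arg_min_variational_inequality[OF convex_X1 convex_f1 _ _ _ assms])
      (auto simp: admm3_def matrix_vector_mult_diff_distrib)
  moreover have "\<gamma> *\<^sub>R ?G (x1 (Suc k))
      = \<gamma> *\<^sub>R (A2 *v x2 k - A2 *v x2 (Suc k)) + \<gamma> *\<^sub>R (x3 k - x3 (Suc k)) - l (Suc k)"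
    using gamma_pos by (simp add: multiplier_Suc residual_def scaleR_diff_right scaleR_add_right)
  ultimately show ?thesis
    by (metis inner_scaleR_right matrix_vector_mult_diff_distrib)
qed

lemma variational_inequality_x2:
  assumes "y \<in> X2"
  shows "0 \<le> f2 y - f2 (x2 (Suc k)) + (A2 *v y - A2 *v x2 (Suc k)) \<bullet>
    (\<gamma> *\<^sub>R (x3 k - x3 (Suc k)) - l (Suc k))"
proof -
  let ?G = "\<lambda>x. A1 *v x1 (Suc k) + A2 *v x + x3 k - b - l k /\<^sub>R \<gamma>"
  have "0 \<le> f2 y - f2 (x2 (Suc k)) + \<gamma> * ((A2 *v (y - x2 (Suc k))) \<bullet> ?G (x2 (Suc k)))"
    using iterates by (intro is_arg_min_variational_inequality[OF convex_X2 convex_f2 _ _ _ assms])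
      (auto simp: admm3_def matrix_vector_mult_diff_distrib)
  moreover have "\<gamma> *\<^sub>R ?G (x2 (Suc k)) = \<gamma> *\<^sub>R (x3 k - x3 (Suc k)) - l (Suc k)"
    using gamma_pos by (simp add: multiplier_Suc residual_def scaleR_diff_right scaleR_add_right)
  ultimately show ?thesis
    by (metis inner_scaleR_right matrix_vector_mult_diff_distrib)
qed

lemma continuous_gradient: "continuous_on UNIV (gradient f3)"
  using lipschitz by (rule lipschitz_on_continuous_on)

lemma continuous_f1: "continuous_on UNIV f1" and continuous_f2: "continuous_on UNIV f2"
  using convex_on_continuous[OF open_UNIV] convex_f1 convex_f2 by blast+

lemma continuous_f3: "continuous_on UNIV f3"
  using differentiable_f3 differentiable_imp_continuous_within continuous_at_imp_continuous_on
  by metis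

section \<open>Boundedness and cluster points of the iterates\<close>

lemma bounded_z:
  assumes "bounded (range (\<lambda>k. A2 *v x2 (Suc k)))" "bounded (range (\<lambda>k. x3 (Suc k)))"
    and "bounded (range (\<lambda>k. residual (Suc k)))"
  shows "bounded (range z)"
proof (rule bounded_range_Suc)
  have "bounded (range (\<lambda>k. residual (Suc k) - A2 *v x2 (Suc k) - x3 (Suc k) + b))"
    using assms by (intro bounded_plus_comp bounded_minus_comp) auto
  then have "bounded (range (\<lambda>k. A1 *v x1 (Suc k)))"
    by (simp add: residual_def)
  then have 1: "bounded (range (\<lambda>k. x1 (Suc k)))"
    by (rule full_column_rank_bounded[OF rank_A1])
  have 2: "bounded (range (\<lambda>k. x2 (Suc k)))"
    using assms(1) by (rule full_column_rank_bounded[OF rank_A2])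
  \<comment> \<open>The multipliers are gradients at the \<open>x3\<close> iterates, and a uniformly
    continuous map preserves boundedness.\<close>
  have "bounded (gradient f3 ` range (\<lambda>k. x3 (Suc k)))"
    using lipschitz_on_uniformly_continuous[OF lipschitz_on_subset[OF lipschitz subset_UNIV]] assms(2)
    by (rule bounded_uniformly_continuous_image)
  then have 3: "bounded (range (\<lambda>k. l (Suc k)))"
    by (simp add: image_image gradient_x3)
  have "range (\<lambda>k. z (Suc k)) \<subseteq> range (\<lambda>k. x1 (Suc k)) \<times> range (\<lambda>k. x2 (Suc k))
      \<times> range (\<lambda>k. x3 (Suc k)) \<times> range (\<lambda>k. l (Suc k))"
    by (auto simp: z_def)
  then show "bounded (range (\<lambda>k. z (Suc k)))"
    using bounded_Times[OF 1 bounded_Times[OF 2 bounded_Times[OF assms(2) 3]]] bounded_subset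
    by blast
qed

lemma cluster_point_optimal:
  assumes res: "residual \<longlonglongrightarrow> 0" and d2: "(\<lambda>k. A2 *v x2 k - A2 *v x2 (Suc k)) \<longlonglongrightarrow> 0"
    and d3: "(\<lambda>k. x3 k - x3 (Suc k)) \<longlonglongrightarrow> 0" and c: "seq_cluster_point z c"
  shows "c \<in> \<Omega>"
proof -
  obtain c1 c2 c3 m where c_eq: "c = (c1, c2, c3, m)" by (metis surj_pair)
  obtain r where r: "strict_mono r" "(z \<circ> r) \<longlonglongrightarrow> c"
    using c unfolding seq_cluster_point_def by blast
  \<comment> \<open>The optimality conditions hold at successor indices only, so the subsequence,
    started at \<open>r (Suc n)\<close> to be positive, is written as
    \<open>Suc (s n)\<close>.\<close>
  define s where "s n = r (Suc n) - 1" for n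
  have r_ge: "Suc n \<le> r (Suc n)" for n using seq_suble[OF r(1)] .
  then have Suc_s: "Suc (s n) = r (Suc n)" for n
    unfolding s_def by (metis Suc_diff_1 Suc_le_D zero_less_Suc)
  have s: "filterlim s at_top sequentially"
    unfolding filterlim_at_top eventually_sequentially
    by (metis Suc_le_mono Suc_s order_trans r_ge)
  have z: "(\<lambda>n. z (Suc (s n))) \<longlonglongrightarrow> (c1, c2, c3, m)"
    using LIMSEQ_Suc[OF r(2)] by (simp add: Suc_s c_eq)
  have x1: "(\<lambda>n. x1 (Suc (s n))) \<longlonglongrightarrow> c1" using tendsto_fst[OF z] by (simp add: z_def)
  have x2: "(\<lambda>n. x2 (Suc (s n))) \<longlonglongrightarrow> c2"
    using tendsto_fst[OF tendsto_snd[OF z]] by (simp add: z_def)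
  have x3: "(\<lambda>n. x3 (Suc (s n))) \<longlonglongrightarrow> c3"
    using tendsto_fst[OF tendsto_snd[OF tendsto_snd[OF z]]] by (simp add: z_def)
  have l: "(\<lambda>n. l (Suc (s n))) \<longlonglongrightarrow> m"
    using tendsto_snd[OF tendsto_snd[OF tendsto_snd[OF z]]] by (simp add: z_def)
  note d2 = filterlim_compose[OF d2 s] and d3 = filterlim_compose[OF d3 s]
  have Ax1: "(\<lambda>n. A1 *v x1 (Suc (s n))) \<longlonglongrightarrow> A1 *v c1"
    and Ax2: "(\<lambda>n. A2 *v x2 (Suc (s n))) \<longlonglongrightarrow> A2 *v c2"
    using x1 x2 by (auto intro: bounded_linear.tendsto[OF matrix_vector_mul_bounded_linear])
  have fx1: "(\<lambda>n. f1 (x1 (Suc (s n)))) \<longlonglongrightarrow> f1 c1" and fx2: "(\<lambda>n. f2 (x2 (Suc (s n)))) \<longlonglongrightarrow> f2 c2"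
    using continuous_on_tendsto_compose[OF continuous_f1 x1]
      continuous_on_tendsto_compose[OF continuous_f2 x2] by simp_all
  have "c1 \<in> X1" using closed_sequentially[OF closed_X1 _ x1] x1_mem by blast
  moreover have "c2 \<in> X2" using closed_sequentially[OF closed_X2 _ x2] x2_mem by blast
  moreover have "gradient f3 c3 = m"
    using continuous_on_tendsto_compose[OF continuous_gradient x3] l LIMSEQ_unique
    by (simp add: gradient_x3)
  moreover have "A1 *v c1 + A2 *v c2 + c3 = b"
  proof -
    have "(\<lambda>n. residual (Suc (s n))) \<longlonglongrightarrow> A1 *v c1 + A2 *v c2 + c3 - b"
      unfolding residual_def by (intro tendsto_intros Ax1 Ax2 x3)
    moreover have "(\<lambda>n. residual (Suc (s n))) \<longlonglongrightarrow> 0"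
      using filterlim_compose[OF LIMSEQ_Suc[OF res] s] .
    ultimately show ?thesis using LIMSEQ_unique eq_iff_diff_eq_0 by blast
  qed
  moreover have "(A1 *v y - A1 *v c1) \<bullet> m \<le> f1 y - f1 c1" if "y \<in> X1" for y
  proof -
    have "(\<lambda>n. f1 y - f1 (x1 (Suc (s n))) + (A1 *v y - A1 *v x1 (Suc (s n))) \<bullet>
        (\<gamma> *\<^sub>R (A2 *v x2 (s n) - A2 *v x2 (Suc (s n))) + \<gamma> *\<^sub>R (x3 (s n) - x3 (Suc (s n))) - l (Suc (s n))))
        \<longlonglongrightarrow> f1 y - f1 c1 + (A1 *v y - A1 *v c1) \<bullet> (\<gamma> *\<^sub>R 0 + \<gamma> *\<^sub>R 0 - m)"
      by (intro tendsto_intros fx1 Ax1 d2 d3 l)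
    then have "0 \<le> f1 y - f1 c1 + (A1 *v y - A1 *v c1) \<bullet> (\<gamma> *\<^sub>R 0 + \<gamma> *\<^sub>R 0 - m)"
      using LIMSEQ_le_const variational_inequality_x1[OF that] by blast
    then show ?thesis by simp
  qed
  moreover have "(A2 *v y - A2 *v c2) \<bullet> m \<le> f2 y - f2 c2" if "y \<in> X2" for y
  proof -
    have "(\<lambda>n. f2 y - f2 (x2 (Suc (s n))) + (A2 *v y - A2 *v x2 (Suc (s n))) \<bullet>
        (\<gamma> *\<^sub>R (x3 (s n) - x3 (Suc (s n))) - l (Suc (s n))))
        \<longlonglongrightarrow> f2 y - f2 c2 + (A2 *v y - A2 *v c2) \<bullet> (\<gamma> *\<^sub>R 0 - m)"
      by (intro tendsto_intros fx2 Ax2 d3 l)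
    then have "0 \<le> f2 y - f2 c2 + (A2 *v y - A2 *v c2) \<bullet> (\<gamma> *\<^sub>R 0 - m)"
      using LIMSEQ_le_const variational_inequality_x2[OF that] by blast
    then show ?thesis by simp
  qed
  ultimately show ?thesis by (simp add: c_eq optimal_pairs_iff)
qed

section \<open>Penalty parameters below twice the modulus of strong convexity\<close>

text \<open>The multiplier \<open>l k\<close> stands in the place of the gradient at
  \<open>x3 k\<close>; the two agree from index 1 on, and with \<open>l k\<close> the decrease holds
  from the arbitrary start as well. An optimal multiplier is determined by \<open>y3\<close>, hence
  the two parameters.\<close>

definition lyapunov :: "real^'n2 \<Rightarrow> real^'p \<Rightarrow> nat \<Rightarrow> real" where
  "lyapunov y2 y3 k = (norm (l k - gradient f3 y3))\<^sup>2 / (2 * \<gamma>)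
     + \<gamma> / 2 * (norm (A2 *v x2 k - A2 *v y2))\<^sup>2 + \<gamma> / 2 * (norm (x3 k - y3))\<^sup>2
     - (f3 y3 - f3 (x3 k) + l k \<bullet> (x3 k - y3))"

lemma lyapunov_Suc:
  assumes "(y1, y2, y3, m) \<in> \<Omega>"
  shows "lyapunov y2 y3 (Suc k) + ((\<sigma> - \<gamma> / 2) * (norm (x3 (Suc k) - y3))\<^sup>2
      + \<gamma> / 2 * (norm (A1 *v x1 (Suc k) - A1 *v y1 + (A2 *v x2 k - A2 *v y2)))\<^sup>2
      + \<gamma> / 2 * (norm (x3 k - x3 (Suc k)))\<^sup>2) \<le> lyapunov y2 y3 k"
proof -
  note y = assms[unfolded optimal_pairs_iff]
  let ?a = "A1 *v x1 (Suc k) - A1 *v y1" and ?v = "A2 *v x2 (Suc k) - A2 *v y2"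
    and ?w = "x3 (Suc k) - y3" and ?v' = "A2 *v x2 k - A2 *v y2" and ?w' = "x3 k - y3"
    and ?\<mu> = "l (Suc k) - m"
  have "?a + ?v + ?w = residual (Suc k)"
    using y by (auto simp: residual_def algebra_simps)
  then have \<mu>0: "l k - m = ?\<mu> + \<gamma> *\<^sub>R (?a + ?v + ?w)"
    by (simp add: multiplier_Suc)
  \<comment> \<open>The iterate's inequality tested at the optimal point and the optimal inequality
    tested at the iterate are added, so the values of \<open>f1\<close> cancel.\<close>
  have 1: "0 \<le> ?a \<bullet> (?\<mu> - \<gamma> *\<^sub>R (?v' - ?v) - \<gamma> *\<^sub>R (?w' - ?w))"
  proof -
    have "0 \<le> f1 y1 - f1 (x1 (Suc k)) + (A1 *v y1 - A1 *v x1 (Suc k)) \<bullet>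
      (\<gamma> *\<^sub>R (A2 *v x2 k - A2 *v x2 (Suc k)) + \<gamma> *\<^sub>R (x3 k - x3 (Suc k)) - l (Suc k))"
      using variational_inequality_x1 y by blast
    moreover have "?a \<bullet> m \<le> f1 (x1 (Suc k)) - f1 y1" using y x1_mem by blast
    ultimately show ?thesis by (simp add: inner_simps algebra_simps)
  qed
  have 2: "0 \<le> ?v \<bullet> (?\<mu> - \<gamma> *\<^sub>R (?w' - ?w))"
  proof -
    have "0 \<le> f2 y2 - f2 (x2 (Suc k)) + (A2 *v y2 - A2 *v x2 (Suc k)) \<bullet>
      (\<gamma> *\<^sub>R (x3 k - x3 (Suc k)) - l (Suc k))"
      using variational_inequality_x2 y by blast
    moreover have "?v \<bullet> m \<le> f2 (x2 (Suc k)) - f2 y2" using y x2_mem by blast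
    ultimately show ?thesis by (simp add: inner_simps algebra_simps)
  qed
  have 3: "\<sigma> * (norm ?w)\<^sup>2 \<le> ?w \<bullet> ?\<mu>"
    using strongly_convex_gradient_monotone[OF strongly_convex_f3, of "x3 (Suc k)" y3] y
    by (simp add: gradient_x3)
  \<comment> \<open>Convexity is used at the new \<open>x3\<close>, where the gradient is the
    multiplier even for \<open>k = 0\<close>.\<close>
  have 4: "0 \<le> f3 (x3 k) - f3 (x3 (Suc k)) - (?\<mu> + m) \<bullet> (?w' - ?w)"
  proof -
    have "f3 (x3 (Suc k)) + (x3 k - x3 (Suc k)) \<bullet> l (Suc k)
        + \<sigma> / 2 * (norm (x3 k - x3 (Suc k)))\<^sup>2 \<le> f3 (x3 k)"
      using strongly_convexD[OF strongly_convex_f3, of "x3 (Suc k)" "x3 k"]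
      by (simp add: gradient_x3)
    moreover have "0 \<le> \<sigma> / 2 * (norm (x3 k - x3 (Suc k)))\<^sup>2" using sigma_pos by simp
    ultimately have "f3 (x3 (Suc k)) + (x3 k - x3 (Suc k)) \<bullet> l (Suc k) \<le> f3 (x3 k)" by linarith
    then show ?thesis by (simp add: inner_commute)
  qed
  show ?thesis
    using lyapunov_decrease[OF gamma_pos \<mu>0 1 2 3 4, of "f3 y3"] y by (simp add: lyapunov_def)
qed

lemma lyapunov_ge:
  "\<gamma> / 2 * (norm (A2 *v x2 k - A2 *v y2))\<^sup>2 + \<sigma> / 2 * (norm (x3 k - y3))\<^sup>2 \<le> lyapunov y2 y3 k"
proof -
  have "\<sigma> / 2 * (norm (x3 k - y3))\<^sup>2 \<le> f3 (x3 k) - f3 y3 - (x3 k - y3) \<bullet> gradient f3 y3"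
    using strongly_convexD[OF strongly_convex_f3, of y3 "x3 k"] by simp
  from lyapunov_lower_bound[OF gamma_pos this, of "A2 *v x2 k - A2 *v y2" "l k - gradient f3 y3"]
  show ?thesis by (simp add: lyapunov_def)
qed

lemma lyapunov_nonneg: "0 \<le> lyapunov y2 y3 k"
  using lyapunov_ge[of k y2 y3] sigma_pos gamma_pos
  by (meson add_nonneg_nonneg half_gt_zero less_imp_le mult_nonneg_nonneg order_trans zero_le_power2)

theorem converges_small_penalty:
  assumes "\<gamma> < 2 * \<sigma>"
  shows "bounded (range z) \<and> (\<exists>w \<in> \<Omega>. z \<longlonglongrightarrow> w)"
proof -
  obtain y1 y2 y3 m where y: "(y1, y2, y3, m) \<in> \<Omega>"
    using optimal_pairs_nonempty by (metis ex_in_conv surj_pair)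
  note y' = y[unfolded optimal_pairs_iff]
  let ?p = "\<lambda>k. A1 *v x1 (Suc k) - A1 *v y1 + (A2 *v x2 k - A2 *v y2)"
  let ?d = "\<lambda>k. (\<sigma> - \<gamma> / 2) * (norm (x3 (Suc k) - y3))\<^sup>2
      + \<gamma> / 2 * (norm (?p k))\<^sup>2 + \<gamma> / 2 * (norm (x3 k - x3 (Suc k)))\<^sup>2"
  have pos: "0 < \<sigma> - \<gamma> / 2" "0 < \<gamma> / 2" using assms gamma_pos by auto
  have nonneg: "0 \<le> (\<sigma> - \<gamma> / 2) * t\<^sup>2" "0 \<le> \<gamma> / 2 * t\<^sup>2" "0 \<le> \<sigma> / 2 * t\<^sup>2" for t
    using pos sigma_pos by simp_all
  have d_nonneg: "0 \<le> ?d k" for k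
    using nonneg(1)[of "norm (x3 (Suc k) - y3)"] nonneg(2)[of "norm (?p k)"]
      nonneg(2)[of "norm (x3 k - x3 (Suc k))"] by linarith
  note lyap = nonincreasing_bounded_below[of "lyapunov y2 y3" ?d, OF lyapunov_Suc[OF y] d_nonneg lyapunov_nonneg]
  have "(\<lambda>k. x3 (Suc k) - y3) \<longlonglongrightarrow> 0"
    using lyap(3) pos(1)
    by (rule tendsto_zero_of_power2)
       (use nonneg(2)[of "norm (?p _)"] nonneg(2)[of "norm (x3 _ - x3 (Suc _))"] in \<open>simp add: add_increasing2\<close>)
  then have x3_Suc: "(\<lambda>k. x3 (Suc k)) \<longlonglongrightarrow> y3" by (simp add: LIM_zero_iff)
  then have x3: "x3 \<longlonglongrightarrow> y3" by (rule LIMSEQ_imp_Suc)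
  have p: "?p \<longlonglongrightarrow> 0"
    using lyap(3) pos(2)
    by (rule tendsto_zero_of_power2)
       (use nonneg(1)[of "norm (x3 (Suc _) - y3)"] nonneg(2)[of "norm (x3 _ - x3 (Suc _))"] in
          \<open>simp add: add_increasing add_increasing2\<close>)
  have d3: "(\<lambda>k. x3 k - x3 (Suc k)) \<longlonglongrightarrow> 0"
    using tendsto_diff[OF x3 x3_Suc] by simp
  have l_Suc: "(\<lambda>k. l (Suc k)) \<longlonglongrightarrow> m"
    using continuous_on_tendsto_compose[OF continuous_gradient x3_Suc] y' by (simp add: gradient_x3)
  then have l: "l \<longlonglongrightarrow> m" by (rule LIMSEQ_imp_Suc)
  have "(\<lambda>k. (1 / \<gamma>) *\<^sub>R (l k - l (Suc k))) \<longlonglongrightarrow> (1 / \<gamma>) *\<^sub>R (m - m)"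
    by (intro tendsto_intros l l_Suc)
  then have res_Suc: "(\<lambda>k. residual (Suc k)) \<longlonglongrightarrow> 0"
    using gamma_pos by (simp add: multiplier_Suc)
  then have res: "residual \<longlonglongrightarrow> 0" by (rule LIMSEQ_imp_Suc)
  \<comment> \<open>The increment of \<open>A2 x2\<close> is not itself dissipated; it is a
    combination of \<open>?p\<close>, the deviation of \<open>x3\<close> and the residual, which all
    vanish.\<close>
  have "(\<lambda>k. ?p k + (x3 (Suc k) - y3) - residual (Suc k)) \<longlonglongrightarrow> 0 + (y3 - y3) - 0"
    by (intro tendsto_intros p x3_Suc res_Suc)
  moreover have "?p k + (x3 (Suc k) - y3) - residual (Suc k) = A2 *v x2 k - A2 *v x2 (Suc k)" for k
    using y' by (auto simp: residual_def algebra_simps)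
  ultimately have d2: "(\<lambda>k. A2 *v x2 k - A2 *v x2 (Suc k)) \<longlonglongrightarrow> 0" by simp
  have bdd_A2: "bounded (range (\<lambda>k. A2 *v x2 k))"
  proof -
    have "norm (A2 *v x2 k) \<le> norm (A2 *v y2) + sqrt (lyapunov y2 y3 0 / (\<gamma> / 2))" for k
    proof -
      have "\<gamma> / 2 * (norm (A2 *v x2 k - A2 *v y2))\<^sup>2 \<le> lyapunov y2 y3 0"
        using lyapunov_ge[of k y2 y3] lyap(1)[of k] nonneg(3)[of "norm (x3 k - y3)"] by linarith
      then have "norm (A2 *v x2 k - A2 *v y2) \<le> sqrt (lyapunov y2 y3 0 / (\<gamma> / 2))"
        using pos(2) by (intro real_le_rsqrt) (simp add: field_simps)
      then show ?thesis using norm_triangle_sub[of "A2 *v x2 k" "A2 *v y2"] by linarith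
    qed
    then show ?thesis by (auto simp: bounded_iff)
  qed
  have bdd_z: "bounded (range z)"
  proof (rule bounded_z)
    show "bounded (range (\<lambda>k. A2 *v x2 (Suc k)))" by (rule bounded_subset[OF bdd_A2]) auto
  qed (use x3_Suc res_Suc convergent_imp_bounded in blast)+
  then obtain c r where r: "strict_mono r" "(z \<circ> r) \<longlonglongrightarrow> c"
    using bounded_imp_convergent_subsequence by blast
  then have "c \<in> \<Omega>"
    using cluster_point_optimal[OF res d2 d3] unfolding seq_cluster_point_def by blast
  \<comment> \<open>The first two components of an optimal pair may fail to be unique, so
    \<open>y\<close> need not be the limit; the Lyapunov function is recentred at the cluster point,
    which shares the last two components with \<open>y\<close>.\<close>
  obtain c1 c2 c3 n where c_eq: "c = (c1, c2, c3, n)" by (metis surj_pair)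
  with \<open>c \<in> \<Omega>\<close> have c: "(c1, c2, c3, n) \<in> \<Omega>" by simp
  have "c3 = y3" "n = m"
    using optimal_pairs_third_unique[OF c y strongly_convex_f3 sigma_pos] by auto
  note c' = c[unfolded optimal_pairs_iff]
  have x3: "x3 \<longlonglongrightarrow> c3" and l: "l \<longlonglongrightarrow> n"
    using x3 l \<open>c3 = y3\<close> \<open>n = m\<close> by auto
  let ?v = "\<lambda>k. A2 *v x2 k - A2 *v c2"
  have "(\<lambda>k. x2 (r k)) \<longlonglongrightarrow> c2"
    using tendsto_fst[OF tendsto_snd[OF r(2)]] by (simp add: c_eq z_def)
  then have "(\<lambda>k. A2 *v x2 (r k)) \<longlonglongrightarrow> A2 *v c2"
    by (rule bounded_linear.tendsto[OF matrix_vector_mul_bounded_linear])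
  moreover have "(\<lambda>k. x3 (r k)) \<longlonglongrightarrow> c3" "(\<lambda>k. l (r k)) \<longlonglongrightarrow> n"
    using LIMSEQ_subseq_LIMSEQ[OF x3 r(1)] LIMSEQ_subseq_LIMSEQ[OF l r(1)] by (simp_all add: o_def)
  moreover from this have "(\<lambda>k. f3 (x3 (r k))) \<longlonglongrightarrow> f3 c3"
    using continuous_on_tendsto_compose[OF continuous_f3] by simp
  ultimately have "(\<lambda>k. lyapunov c2 c3 (r k)) \<longlonglongrightarrow> (norm (n - gradient f3 c3))\<^sup>2 / (2 * \<gamma>)
     + \<gamma> / 2 * (norm (A2 *v c2 - A2 *v c2))\<^sup>2 + \<gamma> / 2 * (norm (c3 - c3))\<^sup>2
     - (f3 c3 - f3 c3 + n \<bullet> (c3 - c3))"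
    unfolding lyapunov_def using gamma_pos by (intro tendsto_intros) auto
  then have sub: "(\<lambda>k. lyapunov c2 c3 (r k)) \<longlonglongrightarrow> 0" using c' by simp
  \<comment> \<open>By monotonicity the recentred function converges along the whole sequence, so
    its limit is the value 0 found along \<open>r\<close>.\<close>
  obtain w where w: "lyapunov c2 c3 \<longlonglongrightarrow> w"
  proof -
    let ?e = "\<lambda>k. (\<sigma> - \<gamma> / 2) * (norm (x3 (Suc k) - c3))\<^sup>2
      + \<gamma> / 2 * (norm (A1 *v x1 (Suc k) - A1 *v c1 + (A2 *v x2 k - A2 *v c2)))\<^sup>2
      + \<gamma> / 2 * (norm (x3 k - x3 (Suc k)))\<^sup>2"
    have "0 \<le> ?e k" for k
      by (intro add_nonneg_nonneg nonneg)
    from nonincreasing_bounded_below(2)[of "lyapunov c2 c3" ?e, OF lyapunov_Suc[OF c] this lyapunov_nonneg]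
    show ?thesis using that by (auto simp: convergent_def)
  qed
  have "w = 0"
    using LIMSEQ_subseq_LIMSEQ[OF w r(1)] sub LIMSEQ_unique unfolding o_def by blast
  with w have "lyapunov c2 c3 \<longlonglongrightarrow> 0" by simp
  then have "?v \<longlonglongrightarrow> 0"
    using pos(2)
    by (rule tendsto_zero_of_power2)
       (rule order_trans[OF _ lyapunov_ge], use nonneg(3) in simp)
  then have A2: "(\<lambda>k. A2 *v x2 k) \<longlonglongrightarrow> A2 *v c2" by (simp add: LIM_zero_iff)
  have "(\<lambda>k. residual k - A2 *v x2 k - x3 k + b) \<longlonglongrightarrow> 0 - A2 *v c2 - c3 + b"
    by (intro tendsto_intros res A2 x3)
  moreover have "0 - A2 *v c2 - c3 + b = A1 *v c1" using c' by (auto simp: algebra_simps)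
  ultimately have "(\<lambda>k. A1 *v x1 k) \<longlonglongrightarrow> A1 *v c1" by (simp add: residual_def)
  then have "x1 \<longlonglongrightarrow> c1" "x2 \<longlonglongrightarrow> c2"
    using full_column_rank_tendsto rank_A1 rank_A2 A2 by blast+
  then have "z \<longlonglongrightarrow> c"
    unfolding z_def[abs_def] c_eq using x3 l by (intro tendsto_Pair)
  with bdd_z \<open>c \<in> \<Omega>\<close> show ?thesis by blast
qed

section \<open>Large penalty parameters\<close>

definition augmented_Lagrangian :: "nat \<Rightarrow> real" where
  "augmented_Lagrangian k = f1 (x1 k) + f2 (x2 k) + f3 (x3 k) - l k \<bullet> residual k
     + \<gamma> / 2 * (norm (residual k))\<^sup>2"

lemma gradient_lipschitz: "norm (gradient f3 x - gradient f3 y) \<le> L * norm (x - y)"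
  using lipschitz_onD[OF lipschitz, of x y] by (simp add: dist_norm)

text \<open>Between 0 and a unit vector, strong monotonicity gives at least \<open>\<sigma>\<close>
  and Cauchy-Schwarz at most \<open>L\<close>. It yields \<open>L < \<gamma>\<close> for large
  penalties.\<close>

lemma modulus_le_lipschitz: "\<sigma> \<le> L"
proof -
  obtain e :: "real^'p" where e: "norm e = 1"
    using norm_Basis SOME_Basis by blast
  have "\<sigma> * (norm e)\<^sup>2 \<le> e \<bullet> (gradient f3 e - gradient f3 0)"
    using strongly_convex_gradient_monotone[OF strongly_convex_f3, of e 0] by simp
  also have "\<dots> \<le> norm e * norm (gradient f3 e - gradient f3 0)" by (rule norm_cauchy_schwarz)
  also have "\<dots> \<le> norm e * (L * norm (e - 0))"
    by (intro mult_left_mono gradient_lipschitz) simp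
  finally show ?thesis using e by simp
qed

text \<open>The negative residual term equals a squared multiplier step over
  \<open>\<gamma>\<close>; multipliers are gradients, so it costs at most
  \<open>L\<^sup>2 / \<gamma>\<close> times the squared step of \<open>x3\<close>. Both multipliers
  must be gradients, hence the start at index 1.\<close>

lemma augmented_Lagrangian_Suc:
  "augmented_Lagrangian (Suc (Suc k))
     + (\<gamma> / 2 * (norm (A2 *v x2 (Suc k) - A2 *v x2 (Suc (Suc k))))\<^sup>2
        + ((\<sigma> + \<gamma>) / 2 - L\<^sup>2 / \<gamma>) * (norm (x3 (Suc k) - x3 (Suc (Suc k))))\<^sup>2)
   \<le> augmented_Lagrangian (Suc k)"
proof -
  let ?p = "A1 *v x1 (Suc k) - A1 *v x1 (Suc (Suc k))"
  let ?q = "A2 *v x2 (Suc k) - A2 *v x2 (Suc (Suc k))"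
  let ?s = "x3 (Suc k) - x3 (Suc (Suc k))" and ?r = "residual (Suc (Suc k))"
  let ?m = "l (Suc k)"
  have m: "l (Suc (Suc k)) = ?m - \<gamma> *\<^sub>R ?r" by (rule multiplier_Suc)
  have 1: "0 \<le> f1 (x1 (Suc k)) - f1 (x1 (Suc (Suc k))) + ?p \<bullet> (\<gamma> *\<^sub>R (?q + ?s + ?r) - ?m)"
    using variational_inequality_x1[OF x1_mem[of k], of "Suc k"] unfolding m
    by (simp add: algebra_simps)
  have 2: "0 \<le> f2 (x2 (Suc k)) - f2 (x2 (Suc (Suc k))) + ?q \<bullet> (\<gamma> *\<^sub>R (?s + ?r) - ?m)"
    using variational_inequality_x2[OF x2_mem[of k], of "Suc k"] unfolding m
    by (simp add: algebra_simps)
  have 3: "\<sigma> / 2 * (norm ?s)\<^sup>2 \<le> f3 (x3 (Suc k)) - f3 (x3 (Suc (Suc k))) - ?s \<bullet> (?m - \<gamma> *\<^sub>R ?r)"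
    using strongly_convexD[OF strongly_convex_f3, of "x3 (Suc (Suc k))" "x3 (Suc k)"]
    by (simp add: gradient_x3 m)
  have "\<gamma> * norm ?r \<le> L * norm ?s"
  proof -
    have "\<gamma> * norm ?r = norm (l (Suc k) - l (Suc (Suc k)))" using gamma_pos by (simp add: m)
    also have "\<dots> \<le> L * norm ?s"
      using gradient_lipschitz[of "x3 (Suc k)" "x3 (Suc (Suc k))"] by (simp add: gradient_x3)
    finally show ?thesis .
  qed
  then have "(\<gamma> * norm ?r)\<^sup>2 \<le> (L * norm ?s)\<^sup>2"
    using gamma_pos by (intro power_mono) auto
  then have r: "\<gamma> * (norm ?r)\<^sup>2 \<le> L\<^sup>2 / \<gamma> * (norm ?s)\<^sup>2"
    using gamma_pos by (simp add: power_mult_distrib field_simps power2_eq_square)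
  have res: "residual (Suc k) = ?p + ?q + ?s + ?r" by (simp add: residual_def)
  have "0 \<le> \<gamma> / 2 * (norm ?p)\<^sup>2" using gamma_pos by simp
  with augmented_Lagrangian_decrease[OF 1 2 3] r show ?thesis
    unfolding augmented_Lagrangian_def res m
    by (simp add: left_diff_distrib)
qed

text \<open>Subtracting the residual from \<open>x3\<close> makes the point feasible. Strong
  convexity at that point gains \<open>\<sigma> / 2\<close>, and replacing its gradient by the
  multiplier loses at most \<open>L\<close>, each times the squared residual.\<close>

lemma augmented_Lagrangian_ge:
  "f1 (x1 (Suc k)) + f2 (x2 (Suc k)) + f3 (x3 (Suc k) - residual (Suc k))
     + ((\<gamma> + \<sigma>) / 2 - L) * (norm (residual (Suc k)))\<^sup>2 \<le> augmented_Lagrangian (Suc k)"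
proof -
  let ?r = "residual (Suc k)" and ?x = "x3 (Suc k)"
  have "f3 (?x - ?r) + ?r \<bullet> gradient f3 (?x - ?r) + \<sigma> / 2 * (norm ?r)\<^sup>2 \<le> f3 ?x"
    using strongly_convexD[OF strongly_convex_f3, of "?x - ?r" ?x] by simp
  moreover have "?r \<bullet> (gradient f3 ?x - gradient f3 (?x - ?r)) \<le> L * (norm ?r)\<^sup>2"
  proof -
    have "?r \<bullet> (gradient f3 ?x - gradient f3 (?x - ?r))
        \<le> norm ?r * norm (gradient f3 ?x - gradient f3 (?x - ?r))" by (rule norm_cauchy_schwarz)
    also have "\<dots> \<le> norm ?r * (L * norm (?x - (?x - ?r)))"
      by (intro mult_left_mono gradient_lipschitz) simp
    finally show ?thesis by (simp add: power2_eq_square ac_simps)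
  qed
  moreover have "?r \<bullet> (gradient f3 ?x - gradient f3 (?x - ?r))
      = l (Suc k) \<bullet> ?r - ?r \<bullet> gradient f3 (?x - ?r)"
    by (simp add: gradient_x3 inner_diff_right inner_commute)
  ultimately show ?thesis
    unfolding augmented_Lagrangian_def by (simp add: algebra_simps add_divide_distrib)
qed

lemma large_penalty_asymptotics:
  assumes gamma_gt: "L\<^sup>2 / \<sigma> < \<gamma>" and bdd_f3: "bdd_below (range f3)"
    and coercive_f1: "coercive (\<lambda>x. ereal (f1 x) + ind_fun X1 x)"
    and coercive_f2: "coercive (\<lambda>x. ereal (f2 x) + ind_fun X2 x)"
  shows "bounded (range z)" "residual \<longlonglongrightarrow> 0"
    "(\<lambda>k. A2 *v x2 k - A2 *v x2 (Suc k)) \<longlonglongrightarrow> 0" "(\<lambda>k. x3 k - x3 (Suc k)) \<longlonglongrightarrow> 0"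
proof -
  let ?aL = "\<lambda>k. augmented_Lagrangian (Suc k)"
  define \<kappa> \<theta> where "\<kappa> = (\<gamma> + \<sigma>) / 2 - L" and "\<theta> = (\<sigma> + \<gamma>) / 2 - L\<^sup>2 / \<gamma>"
  have gs: "L\<^sup>2 < \<gamma> * \<sigma>" using gamma_gt sigma_pos by (simp add: field_simps)
  have L: "\<sigma> \<le> L" by (rule modulus_le_lipschitz)
  have "L < \<gamma>"
  proof -
    have "\<sigma> * L \<le> L * L" using L sigma_pos by (intro mult_right_mono) auto
    then have "\<sigma> * L < \<sigma> * \<gamma>" using gs by (simp add: power2_eq_square ac_simps)
    then show ?thesis using sigma_pos by simp
  qed
  \<comment> \<open>The arithmetic-geometric mean inequality,
    \<open>4 * \<gamma> * \<sigma> \<le> (\<gamma> + \<sigma>)\<^sup>2\<close>, applied to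
    \<open>L\<^sup>2 < \<gamma> * \<sigma>\<close>.\<close>
  have "\<kappa> > 0"
  proof -
    have "(2 * L)\<^sup>2 < (\<gamma> + \<sigma>)\<^sup>2"
      using gs zero_le_power2[of "\<gamma> - \<sigma>"] by (simp add: power2_eq_square algebra_simps)
    then have "2 * L < \<gamma> + \<sigma>"
      by (rule power_less_imp_less_base) (use gamma_pos sigma_pos in simp)
    then show ?thesis by (simp add: \<kappa>_def)
  qed
  \<comment> \<open>Of the two copies of \<open>L\<^sup>2\<close>, one is below
    \<open>\<gamma> * \<sigma>\<close> and the other at most
    \<open>\<gamma>\<^sup>2\<close>.\<close>
  have "\<theta> > 0"
  proof -
    have "L * L \<le> \<gamma> * \<gamma>" using \<open>L < \<gamma>\<close> L sigma_pos by (intro mult_mono) auto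
    then have "2 * L\<^sup>2 < (\<sigma> + \<gamma>) * \<gamma>" using gs by (simp add: power2_eq_square algebra_simps)
    then show ?thesis using gamma_pos by (simp add: \<theta>_def field_simps)
  qed
  obtain y1 y2 y3 m where "(y1, y2, y3, m) \<in> \<Omega>"
    using optimal_pairs_nonempty by (metis ex_in_conv surj_pair)
  then have y: "y1 \<in> X1" "y2 \<in> X2" by (simp_all add: optimal_pairs_iff)
  obtain m1 where m1: "\<And>x. x \<in> X1 \<Longrightarrow> m1 \<le> f1 x"
    using coercive_bdd_below[OF coercive_sublevel_bounded[OF coercive_f1] closed_X1 continuous_f1 y(1)]
    by (auto simp: bdd_below_def)
  obtain m2 where m2: "\<And>x. x \<in> X2 \<Longrightarrow> m2 \<le> f2 x"
    using coercive_bdd_below[OF coercive_sublevel_bounded[OF coercive_f2] closed_X2 continuous_f2 y(2)]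
    by (auto simp: bdd_below_def)
  obtain m3 where m3: "\<And>x. m3 \<le> f3 x" using bdd_f3 by (auto simp: bdd_below_def)
  have ge: "f1 (x1 (Suc k)) + f2 (x2 (Suc k)) + m3 + \<kappa> * (norm (residual (Suc k)))\<^sup>2 \<le> ?aL k" for k
    using augmented_Lagrangian_ge[of k] m3[of "x3 (Suc k) - residual (Suc k)"] by (simp add: \<kappa>_def)
  have pos: "0 \<le> \<kappa> * t\<^sup>2" "0 \<le> \<theta> * t\<^sup>2" "0 \<le> \<gamma> / 2 * t\<^sup>2" for t
    using \<open>\<kappa> > 0\<close> \<open>\<theta> > 0\<close> gamma_pos by simp_all
  have lower: "m1 + m2 + m3 \<le> ?aL k" for k
    using ge[of k] m1[OF x1_mem[of k]] m2[OF x2_mem[of k]] pos(1)[of "norm (residual (Suc k))"]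
    by linarith
  let ?d = "\<lambda>k. \<gamma> / 2 * (norm (A2 *v x2 (Suc k) - A2 *v x2 (Suc (Suc k))))\<^sup>2
        + \<theta> * (norm (x3 (Suc k) - x3 (Suc (Suc k))))\<^sup>2"
  have d_nonneg: "0 \<le> ?d k" for k by (intro add_nonneg_nonneg pos)
  note aL = nonincreasing_bounded_below[of ?aL ?d, OF augmented_Lagrangian_Suc[folded \<theta>_def] d_nonneg lower]
  have "(\<lambda>k. A2 *v x2 (Suc k) - A2 *v x2 (Suc (Suc k))) \<longlonglongrightarrow> 0"
    using aL(3) half_gt_zero[OF gamma_pos] by (rule tendsto_zero_of_power2) (use pos(2) in simp)
  then show "(\<lambda>k. A2 *v x2 k - A2 *v x2 (Suc k)) \<longlonglongrightarrow> 0"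
    by (rule LIMSEQ_imp_Suc)
  have d3_Suc: "(\<lambda>k. x3 (Suc k) - x3 (Suc (Suc k))) \<longlonglongrightarrow> 0"
    using aL(3) \<open>\<theta> > 0\<close> by (rule tendsto_zero_of_power2) (use pos(3) in simp)
  then show "(\<lambda>k. x3 k - x3 (Suc k)) \<longlonglongrightarrow> 0"
    by (rule LIMSEQ_imp_Suc)
  have bound_tendsto: "(\<lambda>k. L / \<gamma> * norm (x3 (Suc k) - x3 (Suc (Suc k)))) \<longlonglongrightarrow> 0"
    using tendsto_mult_right_zero[OF tendsto_norm_zero[OF d3_Suc]] .
  have "norm (residual (Suc (Suc k))) \<le> L / \<gamma> * norm (x3 (Suc k) - x3 (Suc (Suc k)))" for k
  proof -
    have "\<gamma> * norm (residual (Suc (Suc k))) = norm (l (Suc k) - l (Suc (Suc k)))"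
      using gamma_pos by (simp add: multiplier_Suc[of "Suc k"])
    also have "\<dots> \<le> L * norm (x3 (Suc k) - x3 (Suc (Suc k)))"
      using gradient_lipschitz[of "x3 (Suc k)" "x3 (Suc (Suc k))"] by (simp add: gradient_x3)
    finally show ?thesis using gamma_pos by (simp add: field_simps)
  qed
  then have "(\<lambda>k. residual (Suc (Suc k))) \<longlonglongrightarrow> 0"
    by (intro Lim_null_comparison[OF _ bound_tendsto] always_eventually allI)
  then show res: "residual \<longlonglongrightarrow> 0" by (rule LIMSEQ_imp_Suc[OF LIMSEQ_imp_Suc])
  have bdd_res: "bounded (range (\<lambda>k. residual (Suc k)))"
    using LIMSEQ_Suc[OF res] by (rule convergent_imp_bounded)
  \<comment> \<open>Removing the lower bounds of the other terms from the decreasing energy puts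
    \<open>x1\<close> and \<open>x2\<close> into fixed sublevel sets; \<open>x3\<close> is then
    recovered from the residual.\<close>
  have "f1 (x1 (Suc k)) \<le> ?aL 0 - m2 - m3" "f2 (x2 (Suc k)) \<le> ?aL 0 - m1 - m3" for k
    using ge[of k] aL(1)[of k] m1[OF x1_mem[of k]] m2[OF x2_mem[of k]]
      pos(1)[of "norm (residual (Suc k))"] by linarith+
  then have sub1: "range (\<lambda>k. x1 (Suc k)) \<subseteq> {x \<in> X1. f1 x \<le> ?aL 0 - m2 - m3}"
    and sub2: "range (\<lambda>k. x2 (Suc k)) \<subseteq> {x \<in> X2. f2 x \<le> ?aL 0 - m1 - m3}"
    using x1_mem x2_mem by auto
  note bdd_x1 = bounded_subset[OF coercive_sublevel_bounded[OF coercive_f1] sub1]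
    and bdd_x2 = bounded_subset[OF coercive_sublevel_bounded[OF coercive_f2] sub2]
  have bdd: "bounded (range (\<lambda>k. A1 *v x1 (Suc k)))" "bounded (range (\<lambda>k. A2 *v x2 (Suc k)))"
    using bounded_linear_image[OF bdd_x1 matrix_vector_mul_bounded_linear[of A1]]
      bounded_linear_image[OF bdd_x2 matrix_vector_mul_bounded_linear[of A2]]
    by (simp_all add: image_image)
  have "bounded (range (\<lambda>k. residual (Suc k) - A1 *v x1 (Suc k) - A2 *v x2 (Suc k) + b))"
    using bdd bdd_res by (intro bounded_plus_comp bounded_minus_comp) auto
  then have "bounded (range (\<lambda>k. x3 (Suc k)))"
    by (simp add: residual_def)
  from bounded_z[OF bdd(2) this bdd_res] show "bounded (range z)" .
qed

text \<open>The last two components and the sum of the two block images always agree; the rank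
  condition splits this sum, while local strong convexity treats each block separately with the
  common multiplier.\<close>

lemma optimal_pairs_unique:
  assumes "full_column_rank (hcat A1 A2) \<or>
      (locally_strongly_convex A1 X1 f1 ((\<lambda>(y1, y2, y3, m). (y1, m)) ` \<Omega>) \<and>
       locally_strongly_convex A2 X2 f2 ((\<lambda>(y1, y2, y3, m). (y2, m)) ` \<Omega>))"
    and "u \<in> \<Omega>" "v \<in> \<Omega>"
  shows "u = v"
proof -
  obtain u1 u2 u3 m v1 v2 v3 n where uv: "u = (u1, u2, u3, m)" "v = (v1, v2, v3, n)"
    by (metis surj_pair)
  have u: "(u1, u2, u3, m) \<in> \<Omega>" and v: "(v1, v2, v3, n) \<in> \<Omega>" using assms(2,3) uv by auto
  note eq = optimal_pairs_third_unique[OF u v strongly_convex_f3 sigma_pos]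
  note u' = u[unfolded optimal_pairs_iff] and v' = v[unfolded optimal_pairs_iff]
  have "u1 = v1 \<and> u2 = v2"
    using assms(1)
  proof
    assume "full_column_rank (hcat A1 A2)"
    from full_column_rank_hcat_eqD[OF this eq(3)] show ?thesis ..
  next
    assume lsc: "locally_strongly_convex A1 X1 f1 ((\<lambda>(y1, y2, y3, m). (y1, m)) ` \<Omega>) \<and>
       locally_strongly_convex A2 X2 f2 ((\<lambda>(y1, y2, y3, m). (y2, m)) ` \<Omega>)"
    have "(u1, m) \<in> (\<lambda>(y1, y2, y3, m). (y1, m)) ` \<Omega>" "(u2, m) \<in> (\<lambda>(y1, y2, y3, m). (y2, m)) ` \<Omega>"
      using u by force+
    then show ?thesis
      using locally_strongly_convex_unique[OF conjunct1[OF lsc], of u1 m v1]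
        locally_strongly_convex_unique[OF conjunct2[OF lsc], of u2 m v2] u' v' eq(2) by blast
  qed
  then show ?thesis using uv eq by simp
qed

theorem converges_large_penalty:
  assumes "L\<^sup>2 / \<sigma> < \<gamma>" "bdd_below (range f3)"
    and "coercive (\<lambda>x. ereal (f1 x) + ind_fun X1 x)" "coercive (\<lambda>x. ereal (f2 x) + ind_fun X2 x)"
  shows "bounded (range z)" "\<And>c. seq_cluster_point z c \<Longrightarrow> c \<in> \<Omega>"
    "(\<lambda>k. \<bar>f1 (x1 k) + f2 (x2 k) + f3 (x3 k) - opt_val A1 A2 b X1 X2 f1 f2 f3\<bar>) \<longlonglongrightarrow> 0"
    "(\<lambda>k. norm (A1 *v x1 k + A2 *v x2 k + x3 k - b)) \<longlonglongrightarrow> 0"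
    "full_column_rank (hcat A1 A2) \<or>
      (locally_strongly_convex A1 X1 f1 ((\<lambda>(y1, y2, y3, m). (y1, m)) ` \<Omega>) \<and>
       locally_strongly_convex A2 X2 f2 ((\<lambda>(y1, y2, y3, m). (y2, m)) ` \<Omega>))
      \<Longrightarrow> \<exists>w \<in> \<Omega>. z \<longlonglongrightarrow> w"
proof -
  note asym = large_penalty_asymptotics[OF assms]
  show "bounded (range z)" by (rule asym(1))
  show cluster: "c \<in> \<Omega>" if "seq_cluster_point z c" for c
    using cluster_point_optimal[OF asym(2-4) that] .
  let ?F = "\<lambda>(y1, y2, y3, m :: real^'p). f1 y1 + f2 y2 + f3 y3"
  \<comment> \<open>All cluster points have the optimal value, so the objective converges even when
    the iterates might not.\<close>
  have "(\<lambda>k. ?F (z k)) \<longlonglongrightarrow> opt_val A1 A2 b X1 X2 f1 f2 f3"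
  proof (rule tendsto_of_unique_cluster_value[OF asym(1)])
    show "continuous_on UNIV ?F"
      unfolding case_prod_beta
      by (intro continuous_intros continuous_on_compose2[OF continuous_f1]
          continuous_on_compose2[OF continuous_f2] continuous_on_compose2[OF continuous_f3]) auto
  next
    fix c assume "seq_cluster_point z c"
    then have "c \<in> \<Omega>" by (rule cluster)
    moreover obtain c1 c2 c3 m where "c = (c1, c2, c3, m)" by (metis surj_pair)
    ultimately show "?F c = opt_val A1 A2 b X1 X2 f1 f2 f3"
      using optimal_pairs_opt_val[of c1 c2 c3 m A1 A2 b X1 X2 f1 f2 f3] strongly_convex_f3 sigma_pos
      by simp
  qed
  then have "(\<lambda>k. ?F (z k) - opt_val A1 A2 b X1 X2 f1 f2 f3) \<longlonglongrightarrow> 0"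
    by (simp only: LIM_zero_iff)
  then show "(\<lambda>k. \<bar>f1 (x1 k) + f2 (x2 k) + f3 (x3 k) - opt_val A1 A2 b X1 X2 f1 f2 f3\<bar>) \<longlonglongrightarrow> 0"
    by (intro tendsto_rabs_zero) (simp add: z_def)
  show "(\<lambda>k. norm (A1 *v x1 k + A2 *v x2 k + x3 k - b)) \<longlonglongrightarrow> 0"
    using tendsto_norm_zero[OF asym(2)] by (simp add: residual_def)
  assume unique: "full_column_rank (hcat A1 A2) \<or>
      (locally_strongly_convex A1 X1 f1 ((\<lambda>(y1, y2, y3, m). (y1, m)) ` \<Omega>) \<and>
       locally_strongly_convex A2 X2 f2 ((\<lambda>(y1, y2, y3, m). (y2, m)) ` \<Omega>))"
  obtain w where w: "w \<in> \<Omega>" using optimal_pairs_nonempty by blast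
  have "z \<longlonglongrightarrow> w"
    using tendsto_of_unique_cluster_value[OF asym(1) continuous_on_id]
      optimal_pairs_unique[OF unique cluster w] by blast
  with w show "\<exists>w \<in> \<Omega>. z \<longlonglongrightarrow> w" by blast
qed

end

section \<open>Both ranges of the penalty parameter\<close>

theorem theorem3p2:
  fixes A1 :: "real^'n1^'p" and A2 :: "real^'n2^'p" and b :: "real^'p"
    and X1 :: "(real^'n1) set" and X2 :: "(real^'n2) set"
    and f1 :: "real^'n1 \<Rightarrow> real" and f2 :: "real^'n2 \<Rightarrow> real" and f3 :: "real^'p \<Rightarrow> real"
    and \<sigma> L \<gamma> fstar :: real
    and x1 :: "nat \<Rightarrow> real^'n1" and x2 :: "nat \<Rightarrow> real^'n2" and x3 l :: "nat \<Rightarrow> real^'p"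
    and z :: "nat \<Rightarrow> (real^'n1) \<times> (real^'n2) \<times> (real^'p) \<times> (real^'p)"
    and \<Omega> :: "((real^'n1) \<times> (real^'n2) \<times> (real^'p) \<times> (real^'p)) set"
  defines "\<Omega> \<equiv> optimal_pairs A1 A2 b X1 X2 f1 f2 f3"
    and "fstar \<equiv> opt_val A1 A2 b X1 X2 f1 f2 f3"
    and "z \<equiv> \<lambda>k. (x1 k, x2 k, x3 k, l k)"
  assumes "closed X1" "convex X1" "closed X2" "convex X2"
    and "lower_semicont f1" "closed (epigraph UNIV f1)" "convex_on UNIV f1"
    and "lower_semicont f2" "closed (epigraph UNIV f2)" "convex_on UNIV f2"
    and "\<forall>x. f3 differentiable (at x)" "bdd_below (range f3)"
    and "\<sigma> > 0" "strongly_convex \<sigma> f3"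
    and "L > 0" "L-lipschitz_on UNIV (gradient f3)"
    and "\<Omega> \<noteq> {}"
    and "full_column_rank A1" "full_column_rank A2"
    and "coercive (\<lambda>x. ereal (f1 x) + ind_fun X1 x)"
    and "coercive (\<lambda>x. ereal (f2 x) + ind_fun X2 x)"
    and "\<gamma> > 0"
    and "admm3 A1 A2 b X1 X2 f1 f2 f3 \<gamma> x1 x2 x3 l"
  shows "(\<gamma> \<in> {L\<^sup>2 / \<sigma> <..} \<longrightarrow>
            bounded (range z) \<and>
            (\<forall>c. seq_cluster_point z c \<longrightarrow> c \<in> \<Omega>) \<and>
            (\<lambda>k. \<bar>f1 (x1 k) + f2 (x2 k) + f3 (x3 k) - fstar\<bar>) \<longlonglongrightarrow> 0 \<and>
            (\<lambda>k. norm (A1 *v x1 k + A2 *v x2 k + x3 k - b)) \<longlonglongrightarrow> 0 \<and>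
            (full_column_rank (hcat A1 A2) \<or>
             (locally_strongly_convex A1 X1 f1 ((\<lambda>(y1, y2, y3, m). (y1, m)) ` \<Omega>) \<and>
              locally_strongly_convex A2 X2 f2 ((\<lambda>(y1, y2, y3, m). (y2, m)) ` \<Omega>))
             \<longrightarrow> (\<exists>w \<in> \<Omega>. z \<longlonglongrightarrow> w)))
       \<and> (\<forall>\<eta>1 > 2. \<forall>\<eta>2 > 2.
            \<gamma> \<in> {sqrt (\<sigma>\<^sup>2 + 2 * L\<^sup>2 / (\<eta>1 - 2)) - \<sigma> <.. 4 * \<sigma> / \<eta>1} \<union>
                 {0 <..< min (4 * \<sigma> / \<eta>2)
                             (\<sigma> * (\<eta>2 - 2) / (4 * \<eta>2) +
                              sqrt (\<sigma>\<^sup>2 * (\<eta>2 - 2)\<^sup>2 / (16 * \<eta>2\<^sup>2) + \<sigma>\<^sup>2 * (\<eta>2 - 2) / (4 * \<eta>2)))}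
            \<longrightarrow> bounded (range z) \<and> (\<exists>w \<in> \<Omega>. z \<longlonglongrightarrow> w))"
proof -
  interpret admm: three_block_admm A1 A2 b X1 X2 f1 f2 f3 \<sigma> L \<gamma> x1 x2 x3 l
    using assms by unfold_locales auto
  have z: "z = admm.z" by (simp add: z_def admm.z_def fun_eq_iff)
  show ?thesis
  proof (rule conjI; intro impI allI)
    assume "\<gamma> \<in> {L\<^sup>2 / \<sigma> <..}"
    then have "L\<^sup>2 / \<sigma> < \<gamma>" by simp
    note large = admm.converges_large_penalty[OF this \<open>bdd_below (range f3)\<close>
        \<open>coercive (\<lambda>x. ereal (f1 x) + ind_fun X1 x)\<close> \<open>coercive (\<lambda>x. ereal (f2 x) + ind_fun X2 x)\<close>,
        folded z \<Omega>_def fstar_def]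
    show "bounded (range z) \<and>
            (\<forall>c. seq_cluster_point z c \<longrightarrow> c \<in> \<Omega>) \<and>
            (\<lambda>k. \<bar>f1 (x1 k) + f2 (x2 k) + f3 (x3 k) - fstar\<bar>) \<longlonglongrightarrow> 0 \<and>
            (\<lambda>k. norm (A1 *v x1 k + A2 *v x2 k + x3 k - b)) \<longlonglongrightarrow> 0 \<and>
            (full_column_rank (hcat A1 A2) \<or>
             (locally_strongly_convex A1 X1 f1 ((\<lambda>(y1, y2, y3, m). (y1, m)) ` \<Omega>) \<and>
              locally_strongly_convex A2 X2 f2 ((\<lambda>(y1, y2, y3, m). (y2, m)) ` \<Omega>))
             \<longrightarrow> (\<exists>w \<in> \<Omega>. z \<longlonglongrightarrow> w))"
      by (intro conjI allI impI large)
  next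
    fix \<eta>1 \<eta>2 :: real
    assume "\<eta>1 > 2" "\<eta>2 > 2"
      and \<gamma>: "\<gamma> \<in> {sqrt (\<sigma>\<^sup>2 + 2 * L\<^sup>2 / (\<eta>1 - 2)) - \<sigma> <.. 4 * \<sigma> / \<eta>1} \<union>
        {0 <..< min (4 * \<sigma> / \<eta>2) (\<sigma> * (\<eta>2 - 2) / (4 * \<eta>2) +
          sqrt (\<sigma>\<^sup>2 * (\<eta>2 - 2)\<^sup>2 / (16 * \<eta>2\<^sup>2) + \<sigma>\<^sup>2 * (\<eta>2 - 2) / (4 * \<eta>2)))}"
    \<comment> \<open>Each of the two ranges lies below or at \<open>4 * \<sigma> / \<eta>\<close>
      for its own \<open>\<eta>\<close>.\<close>
    have "4 * \<sigma> / \<eta> < 2 * \<sigma>" if "\<eta> > 2" for \<eta>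
      using that \<open>\<sigma> > 0\<close> by (simp add: field_simps)
    from this[OF \<open>\<eta>1 > 2\<close>] this[OF \<open>\<eta>2 > 2\<close>] have "\<gamma> < 2 * \<sigma>"
      using \<gamma> by (simp only: Un_iff greaterThanAtMost_iff greaterThanLessThan_iff min_less_iff_conj) linarith
    from admm.converges_small_penalty[OF this, folded z \<Omega>_def]
    show "bounded (range z) \<and> (\<exists>w \<in> \<Omega>. z \<longlonglongrightarrow> w)" .
  qed
qed

end
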